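(* Consider the SDDE of the context, driven by a $d$-dimensional Brownian motion. If $f$ and $g$ satisfy Assumption S1 and $h^\delta$ satisfies Assumption S2 (both stated in the context), then the discrete-time adaptive approximate solution $\{\hat X_{t_n}\}_{n\ge0}$ is almost surely exponentially stable, i.e. there exists $\lambda>0$ such that $$\limsup_{n\to\infty}\frac{\log|\hat X_{t_n}|}{t_n}\le-\lambda\quad\text{a.s.}$$
   Context: Setting. Let $(\Omega,\mathcal F,\mathbb P)$ be a complete probability space with a filtration $\{\mathcal F_t\}_{t\ge0}$ satisfying the usual conditions, and let $W$ be a standard $d$-dimensional Brownian motion on it. $|\cdot|$ is the Euclidean norm, $\langle\cdot,\cdot\rangle$ the inner product, $\|A\|=\sqrt{\mathrm{trace}(A^TA)}$ for matrices. Let $\tau>0$; $C([-\tau,0];\mathbb R^m)$ carries the norm $\|\phi\|=\sup_{-\tau\le\theta\le0}|\phi(\theta)|$. Consider the SDDE $$dY_t=f(Y_t,Y_{t-\tau})\,dt+g(Y_t,Y_{t-\tau})\,dW_t,\quad t\ge0,\qquad Y_\theta=\xi(\theta),\ \theta\in[-\tau,0],$$ with $f:\mathbb R^m\times\mathbb R^m\to\mathbb R^m$, $g:\mathbb R^m\times\mathbb R^m\to\mathbb R^{m\times d}$ Borel measurable and $\xi$ an $\mathcal F_0$-measurable $C([-\tau,0];\mathbb R^m)$-valued random variable with $\mathbb E\|\xi\|^p<\infty$ for every $p\ge2$. Adaptive scheme. For $\delta\in(0,1)$ let $h^\delta:\mathbb R^m\to\mathbb R^+$. Set $t_0=0$,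 $\hat X_{0}=\xi(0)$, $\bar X_t=\xi(t)$ for $t\in[-\tau,0)$, and recursively (pathwise) for all $n\ge0$: $h^\delta_n=h^\delta(\hat X_{t_n})$, $t_{n+1}=t_n+h^\delta_n$, $\bar X_t=\hat X_{t_n}$ for $t\in[t_n,t_{n+1})$, and $$\hat X_{t_{n+1}}=\hat X_{t_n}+f(\bar X_{t_n},\bar X_{t_n-\tau})h^\delta_n+g(\bar X_{t_n},\bar X_{t_n-\tau})(W_{t_{n+1}}-W_{t_n}).$$ Convention: $\log 0=-\infty$. Assumption S1. (i) For every $R>0$ there is $C_R>0$ such that $|f(x,y)-f(\bar x,\bar y)|+\|g(x,y)-g(\bar x,\bar y)\|\le C_R(|x-\bar x|+|y-\bar y|)$ for all $x,y,\bar x,\bar y\in\mathbb R^m$ with $|x|,|y|,|\bar x|,|\bar y|\le R$. (ii) There exist constants $\alpha_1>2\alpha_2\ge0$ such that for all $x,y\in\mathbb R^m$: $\langle x,f(x,y)\rangle+\tfrac12\|g(x,y)\|^2\le-\alpha_1|x|^2+\alpha_2|y|^2$. Assumption S2. For every $\delta$, the function $h^\delta:\mathbb R^m\to\mathbb R^+$ is continuous and there exist constants $\alpha_1>\alpha_2\ge0$ such that for all $x,y\in\mathbb R^m$, $$\langle x,f(x,y)\rangle+\tfrac12h^\delta(x)|f(x,y)|^2+\tfrac d2\|g(x,y)\|^2\le-\alpha_1|x|^2+\alpha_2\frac{\min(h^\delta(y),h^\delta(x))}{h^\delta(x)}|y|^2 .$$ Furthermore, there are real numbers $0<h^\delta_{\min}<h^\delta_{\max}<1$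 with $h^\delta_{\min}\le h^\delta(x)\le h^\delta_{\max}$ for all $x\in\mathbb R^m$, where $h^\delta_{\max}$ is small enough that $2\alpha_2e^{2\alpha_1h^\delta_{\max}}<\alpha_1$ (with the constants $\alpha_1,\alpha_2$ of this assumption). *)

theory Defs
  imports "HOL-Probability.Probability"
begin

section \<open>Probabilistic setting\<close>

text \<open>
  Time is the nonnegative half-line: the values of \<open>F\<close> and \<open>W\<close> at negative arguments are never used.
\<close>

definition usual_conditions :: "'a measure \<Rightarrow> (real \<Rightarrow> 'a measure) \<Rightarrow> bool" where
  "usual_conditions M F \<longleftrightarrow>
     (\<forall>t\<ge>0. subalgebra M (F t)) \<and>
     (\<forall>s t. 0 \<le> s \<longrightarrow> s \<le> t \<longrightarrow> sets (F s) \<subseteq> sets (F t)) \<and>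
     null_sets M \<subseteq> sets (F 0) \<and>
     (\<forall>t\<ge>0. sets (F t) = (\<Inter>s\<in>{t<..}. sets (F s)))"

definition std_brownian_motion ::
  "'a measure \<Rightarrow> (real \<Rightarrow> 'a measure) \<Rightarrow> (real \<Rightarrow> 'a \<Rightarrow> real ^ 'd) \<Rightarrow> bool" where
  "std_brownian_motion M F W \<longleftrightarrow>
     (\<forall>t\<ge>0. W t \<in> borel_measurable (F t)) \<and>
     (AE \<omega> in M. W 0 \<omega> = 0) \<and>
     (AE \<omega> in M. continuous_on {0..} (\<lambda>t. W t \<omega>)) \<and>
     (\<forall>s t. 0 \<le> s \<longrightarrow> s < t \<longrightarrow>
        prob_space.indep_set M (sets (F s))
          (sets (vimage_algebra (space M) (\<lambda>\<omega>. W t \<omega> - W s \<omega>) borel)) \<and>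
        prob_space.indep_vars M (\<lambda>_. borel) (\<lambda>i \<omega>. (W t \<omega> - W s \<omega>) $ i) UNIV \<and>
        (\<forall>i. distributed M lborel (\<lambda>\<omega>. (W t \<omega> - W s \<omega>) $ i) (normal_density 0 (sqrt (t - s)))))"

text \<open>
  \<open>segment_space \<tau>\<close> is \<open>C([-\<tau>,0]; \<real>\<^sup>m)\<close> with the supremum distance; its elements are
  \<open>undefined\<close> outside \<open>[-\<tau>,0]\<close>.
\<close>

definition segment_space :: "real \<Rightarrow> (real \<Rightarrow> real ^ 'm) metric" where
  "segment_space \<tau> = cfunspace (top_of_set {-\<tau>..0}) euclidean_metric"

definition segment_borel :: "real \<Rightarrow> (real \<Rightarrow> real ^ 'm) measure" where
  "segment_borel \<tau> =
     sigma (mspace (segment_space \<tau>)) {U. openin (mtopology_of (segment_space \<tau>)) U}"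

definition segment_norm :: "real \<Rightarrow> (real \<Rightarrow> real ^ 'm) \<Rightarrow> real" where
  "segment_norm \<tau> \<phi> = (SUP \<theta>\<in>{-\<tau>..0}. norm (\<phi> \<theta>))"

definition initial_segment ::
  "'a measure \<Rightarrow> (real \<Rightarrow> 'a measure) \<Rightarrow> real \<Rightarrow> ('a \<Rightarrow> real \<Rightarrow> real ^ 'm) \<Rightarrow> bool" where
  "initial_segment M F \<tau> \<xi> \<longleftrightarrow>
     \<xi> \<in> F 0 \<rightarrow>\<^sub>M segment_borel \<tau> \<and>
     (\<forall>p::real. p \<ge> 2 \<longrightarrow> integrable M (\<lambda>\<omega>. segment_norm \<tau> (\<xi> \<omega>) powr p))"

section \<open>Assumptions on the coefficients and on the step size\<close>

definition hs_norm :: "real ^ 'd ^ 'm \<Rightarrow> real" where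
  "hs_norm A = sqrt (trace (transpose A ** A))"

definition assumption_S1 ::
  "(real ^ 'm \<Rightarrow> real ^ 'm \<Rightarrow> real ^ 'm) \<Rightarrow> (real ^ 'm \<Rightarrow> real ^ 'm \<Rightarrow> real ^ 'd ^ 'm) \<Rightarrow> bool" where
  "assumption_S1 f g \<longleftrightarrow>
     (\<forall>R>0. \<exists>C>0. \<forall>x y x' y'.
        norm x \<le> R \<longrightarrow> norm y \<le> R \<longrightarrow> norm x' \<le> R \<longrightarrow> norm y' \<le> R \<longrightarrow>
        norm (f x y - f x' y') + hs_norm (g x y - g x' y')
          \<le> C * (norm (x - x') + norm (y - y'))) \<and>
     (\<exists>\<alpha>\<^sub>1 \<alpha>\<^sub>2. \<alpha>\<^sub>1 > 2 * \<alpha>\<^sub>2 \<and> 2 * \<alpha>\<^sub>2 \<ge> 0 \<and>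
        (\<forall>x y. x \<bullet> f x y + 1 / 2 * (hs_norm (g x y))\<^sup>2
                 \<le> - \<alpha>\<^sub>1 * (norm x)\<^sup>2 + \<alpha>\<^sub>2 * (norm y)\<^sup>2))"

text \<open>
  \<open>h \<delta>\<close> is the step-size function \<open>h\<^sup>\<delta>\<close>. All constants may depend on \<open>\<delta>\<close>, and they are
  not related to the constants of \<^const>\<open>assumption_S1\<close>.
\<close>

definition assumption_S2 ::
  "(real ^ 'm \<Rightarrow> real ^ 'm \<Rightarrow> real ^ 'm) \<Rightarrow> (real ^ 'm \<Rightarrow> real ^ 'm \<Rightarrow> real ^ 'd ^ 'm) \<Rightarrow>
   (real \<Rightarrow> real ^ 'm \<Rightarrow> real) \<Rightarrow> bool" where
  "assumption_S2 f g h \<longleftrightarrow>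
     (\<forall>\<delta>\<in>{0<..<1}.
        continuous_on UNIV (h \<delta>) \<and> (\<forall>x. h \<delta> x > 0) \<and>
        (\<exists>\<alpha>\<^sub>1 \<alpha>\<^sub>2. \<alpha>\<^sub>1 > \<alpha>\<^sub>2 \<and> \<alpha>\<^sub>2 \<ge> 0 \<and>
           (\<forall>x y. x \<bullet> f x y + 1 / 2 * h \<delta> x * (norm (f x y))\<^sup>2
                    + real CARD('d) / 2 * (hs_norm (g x y))\<^sup>2
                  \<le> - \<alpha>\<^sub>1 * (norm x)\<^sup>2
                    + \<alpha>\<^sub>2 * (min (h \<delta> y) (h \<delta> x) / h \<delta> x) * (norm y)\<^sup>2) \<and>
           (\<exists>h_min h_max. 0 < h_min \<and> h_min < h_max \<and> h_max < 1 \<and>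
              (\<forall>x. h_min \<le> h \<delta> x \<and> h \<delta> x \<le> h_max) \<and>
              2 * \<alpha>\<^sub>2 * exp (2 * \<alpha>\<^sub>1 * h_max) < \<alpha>\<^sub>1)))"

section \<open>The adaptive scheme\<close>

text \<open>
  The scheme is defined for one realisation \<open>\<xi>\<close> of the initial segment and one Brownian path \<open>w\<close>.
  The state after \<open>n\<close> steps is the pair of the grid point \<open>t\<^sub>n\<close> and the piecewise constant process
  constructed so far: a function that agrees with \<open>\<xi>\<close> before time \<open>0\<close>, equals the value at
  \<open>t\<^sub>k\<close> on \<open>[t\<^sub>k, t\<^sub>k\<^sub>+\<^sub>1)\<close> for \<open>k < n\<close>, and equals the value at \<open>t\<^sub>n\<close> from \<open>t\<^sub>n\<close> on.
  Positivity of \<open>h\<close> is not needed for the definition. The lemmas below derive from it the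
  recursion in its usual form.
\<close>

primrec scheme_state ::
  "(real ^ 'm \<Rightarrow> real) \<Rightarrow> (real ^ 'm \<Rightarrow> real ^ 'm \<Rightarrow> real ^ 'm) \<Rightarrow>
   (real ^ 'm \<Rightarrow> real ^ 'm \<Rightarrow> real ^ 'd ^ 'm) \<Rightarrow> real \<Rightarrow> (real \<Rightarrow> real ^ 'm) \<Rightarrow>
   (real \<Rightarrow> real ^ 'd) \<Rightarrow> nat \<Rightarrow> real \<times> (real \<Rightarrow> real ^ 'm)" where
  "scheme_state h f g \<tau> \<xi> w 0 = (0, \<lambda>s. if s < 0 then \<xi> s else \<xi> 0)"
| "scheme_state h f g \<tau> \<xi> w (Suc n) =
     (let (t, X) = scheme_state h f g \<tau> \<xi> w n;
          t' = t + h (X t);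
          x' = X t + h (X t) *\<^sub>R f (X t) (X (t - \<tau>)) + g (X t) (X (t - \<tau>)) *v (w t' - w t)
      in (t', \<lambda>s. if s < t' then X s else x'))"

definition scheme_time where
  "scheme_time h f g \<tau> \<xi> w n = fst (scheme_state h f g \<tau> \<xi> w n)"

definition scheme_value where
  "scheme_value h f g \<tau> \<xi> w n =
     snd (scheme_state h f g \<tau> \<xi> w n) (scheme_time h f g \<tau> \<xi> w n)"

definition scheme_step_process where
  "scheme_step_process h f g \<tau> \<xi> w s =
     (if s < 0 then \<xi> s
      else scheme_value h f g \<tau> \<xi> w
             (THE n. scheme_time h f g \<tau> \<xi> w n \<le> s \<and> s < scheme_time h f g \<tau> \<xi> w (Suc n)))"

context
  fixes h :: "real ^ 'm \<Rightarrow> real"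
    and f :: "real ^ 'm \<Rightarrow> real ^ 'm \<Rightarrow> real ^ 'm"
    and g :: "real ^ 'm \<Rightarrow> real ^ 'm \<Rightarrow> real ^ 'd ^ 'm"
    and \<tau> :: real and \<xi> :: "real \<Rightarrow> real ^ 'm" and w :: "real \<Rightarrow> real ^ 'd"
  assumes h_pos: "\<And>x. h x > 0"
begin

abbreviation (input) "tn \<equiv> scheme_time h f g \<tau> \<xi> w"
abbreviation (input) "Xn \<equiv> scheme_value h f g \<tau> \<xi> w"
abbreviation (input) "Xbar \<equiv> scheme_step_process h f g \<tau> \<xi> w"

lemma scheme_time_0: "tn 0 = 0"
  by (simp add: scheme_time_def)

lemma scheme_value_0: "Xn 0 = \<xi> 0"
  by (simp add: scheme_value_def scheme_time_def)

lemma scheme_time_Suc: "tn (Suc n) = tn n + h (Xn n)"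
  by (simp add: scheme_value_def scheme_time_def Let_def split_beta)

lemma strict_mono_scheme_time: "strict_mono tn"
  by (rule strict_monoI_Suc) (simp add: scheme_time_Suc h_pos)

lemma scheme_step_process_neg: "s < 0 \<Longrightarrow> Xbar s = \<xi> s"
  by (simp add: scheme_step_process_def)

lemma scheme_step_process_eq:
  assumes "tn n \<le> s" "s < tn (Suc n)"
  shows "Xbar s = Xn n"
proof -
  have "0 \<le> s"
    using assms(1) strict_mono_less_eq[OF strict_mono_scheme_time, of 0 n] by (simp add: scheme_time_0)
  moreover have "(THE k. tn k \<le> s \<and> s < tn (Suc k)) = n"
  proof (rule the_equality)
    fix k assume k: "tn k \<le> s \<and> s < tn (Suc k)"
    have "tn k < tn (Suc n)" "tn n < tn (Suc k)" using k assms by auto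
    then show "k = n"
      by (simp add: strict_mono_less[OF strict_mono_scheme_time])
  qed (use assms in auto)
  ultimately show ?thesis by (simp add: scheme_step_process_def)
qed

lemma scheme_state_eq: "s < tn (Suc n) \<Longrightarrow> snd (scheme_state h f g \<tau> \<xi> w n) s = Xbar s"
proof (induction n)
  case 0
  show ?case
  proof (cases "s < 0")
    case False
    with 0 show ?thesis
      using scheme_step_process_eq[of 0 s] by (simp add: scheme_time_0 scheme_value_0)
  qed (simp add: scheme_step_process_neg)
next
  case (Suc n)
  show ?case
  proof (cases "s < tn (Suc n)")
    case True
    then show ?thesis using Suc.IH by (simp add: Let_def split_beta scheme_time_def)
  next
    case False
    then show ?thesis using Suc.prems scheme_step_process_eq[of "Suc n" s]
      by (simp add: Let_def split_beta scheme_time_def scheme_value_def)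
  qed
qed

lemma scheme_value_Suc:
  assumes "\<tau> > 0"
  shows "Xn (Suc n) = Xn n + h (Xn n) *\<^sub>R f (Xbar (tn n)) (Xbar (tn n - \<tau>))
           + g (Xbar (tn n)) (Xbar (tn n - \<tau>)) *v (w (tn (Suc n)) - w (tn n))"
proof -
  have lt: "tn n < tn (Suc n)" by (simp add: scheme_time_Suc h_pos)
  have "snd (scheme_state h f g \<tau> \<xi> w n) (tn n - \<tau>) = Xbar (tn n - \<tau>)"
    using lt assms by (intro scheme_state_eq) auto
  moreover have "Xbar (tn n) = Xn n"
    using lt by (intro scheme_step_process_eq) auto
  ultimately show ?thesis
    by (simp add: scheme_value_def scheme_time_def Let_def split_beta)
qed

end

section \<open>Logarithm\<close>

definition elog :: "real \<Rightarrow> ereal" where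
  "elog r = (if r = 0 then -\<infinity> else ereal (ln r))"

end

theory Submission
  imports Defs
begin

text \<open>
  Given the past at \<open>t\<^sub>n\<close>, the increment \<open>W t\<^sub>n\<^sub>+\<^sub>1 - W t\<^sub>n\<close> has mean zero and second moment at most \<open>d h\<^sub>n\<close>, so S2 gives
  \<open>E |X\<^sub>n\<^sub>+\<^sub>1|\<^sup>2 \<le> E ((1 - 2 \<alpha>\<^sub>1 h\<^sub>n) |X\<^sub>n|\<^sup>2 + 2 \<alpha>\<^sub>2 min (h Y\<^sub>n) h\<^sub>n |Y\<^sub>n|\<^sup>2)\<close> with \<open>Y\<^sub>n\<close> the delayed value, also
  with the weight \<open>exp (\<mu> t\<^sub>n\<^sub>+\<^sub>1)\<close>, which is known at \<open>t\<^sub>n\<close>. A value \<open>X\<^sub>k\<close> serves as delayed value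
  during a time span of length \<open>h\<^sub>k\<close>, so the delay terms it causes sum up to at most \<open>2 h\<^sub>k\<close> times
  \<open>2 \<alpha>\<^sub>2 |X\<^sub>k|\<^sup>2\<close>, up to a weight close to 1 for small \<open>\<mu>\<close>, and are absorbed by the dissipation as
  \<open>2 \<alpha>\<^sub>2 < \<alpha>\<^sub>1\<close>. Hence \<open>E (exp (\<mu> t\<^sub>n) |X\<^sub>n|\<^sup>2)\<close> is bounded in \<open>n\<close>, and as \<open>t\<^sub>n \<ge> n h\<^sub>m\<^sub>i\<^sub>n\<close>, the series
  \<open>\<Sum>n. exp (\<mu> t\<^sub>n / 2) |X\<^sub>n|\<^sup>2\<close> has finite expectation; its terms are therefore almost surely bounded.
\<close>

section \<open>Matrix norms and measurability of matrix-vector products\<close>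

lemma hs_norm_eq_norm: "hs_norm A = norm A"
proof -
  have "trace (transpose A ** A) = (\<Sum>j\<in>UNIV. \<Sum>i\<in>UNIV. A $ i $ j * A $ i $ j)"
    by (simp add: trace_def matrix_matrix_mult_def transpose_def)
  also have "\<dots> = (\<Sum>i\<in>UNIV. \<Sum>j\<in>UNIV. A $ i $ j * A $ i $ j)"
    by (rule sum.swap)
  also have "\<dots> = A \<bullet> A"
    by (simp add: inner_vec_def)
  finally show ?thesis
    by (simp add: hs_norm_def norm_eq_sqrt_inner)
qed

text \<open>Cauchy-Schwarz in each row. For an increment whose d components have variance r, this
  bounds the mean square of the product by d r times the squared matrix norm; the factor d/2 in S2
  matches that d.\<close>

lemma norm_matrix_vector_mult_le: "norm (A *v x) \<le> norm A * norm x"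
  for A :: "real ^ 'n ^ 'm"
proof -
  have "norm (A *v x) = L2_set (\<lambda>i. norm (A $ i \<bullet> x)) UNIV"
    by (simp add: norm_vec_def matrix_vector_mul_component)
  also have "\<dots> \<le> L2_set (\<lambda>i. norm (A $ i) * norm x) UNIV"
    by (intro L2_set_mono) (auto intro: Cauchy_Schwarz_ineq2)
  also have "\<dots> = norm A * norm x"
    by (simp add: norm_vec_def[of A] L2_set_left_distrib)
  finally show ?thesis .
qed

lemma borel_measurable_matrix_vector_mult [measurable (raw)]:
  fixes A :: "'a \<Rightarrow> real ^ 'n ^ 'm"
  assumes "A \<in> borel_measurable M" "v \<in> borel_measurable M"
  shows "(\<lambda>\<omega>. A \<omega> *v v \<omega>) \<in> borel_measurable M"
proof (rule borel_measurable_continuous_Pair[OF assms])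
  show "continuous_on UNIV (\<lambda>x. fst x *v snd x :: real ^ 'm)"
    unfolding matrix_vector_mult_def
    by (intro continuous_on_vec_lambda continuous_intros)
qed

section \<open>Continuous processes at random times\<close>

text \<open>The values \<open>\<lceil>i u\<rceil> / i\<close> with \<open>i \<rightarrow> \<infinity>\<close> approximate the random time \<open>u\<close> by countably many
  deterministic ones.\<close>

lemma LIMSEQ_ceiling_grid: "(\<lambda>i. of_int \<lceil>real (Suc i) * u\<rceil> / real (Suc i)) \<longlonglongrightarrow> u"
proof (rule tendsto_sandwich)
  show "\<forall>\<^sub>F i in sequentially. u \<le> of_int \<lceil>real (Suc i) * u\<rceil> / real (Suc i)"
    by (intro always_eventually allI) (simp add: pos_le_divide_eq mult.commute del: of_nat_Suc)
  show "\<forall>\<^sub>F i in sequentially. of_int \<lceil>real (Suc i) * u\<rceil> / real (Suc i) \<le> u + inverse (real (Suc i))"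
  proof (intro always_eventually allI)
    fix i
    have "of_int \<lceil>real (Suc i) * u\<rceil> \<le> real (Suc i) * u + 1" by linarith
    then show "of_int \<lceil>real (Suc i) * u\<rceil> / real (Suc i) \<le> u + inverse (real (Suc i))"
      by (simp add: field_simps del: of_nat_Suc)
  qed
  show "(\<lambda>i. u + inverse (real (Suc i))) \<longlonglongrightarrow> u"
    using tendsto_add[OF tendsto_const LIMSEQ_inverse_real_of_nat, of u] by simp
qed auto

lemma LIMSEQ_floor_grid: "(\<lambda>i. of_int \<lfloor>real (Suc i) * u\<rfloor> / real (Suc i)) \<longlonglongrightarrow> u"
  using tendsto_minus[OF LIMSEQ_ceiling_grid[of "- u"]]
  by (simp add: ceiling_def del: of_nat_Suc)

text \<open>A rounded time takes countably many values, at each of which \<open>Z\<close> is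
  measurable; path continuity passes to the limit. Rounding may leave the index set
  \<open>I\<close>, so the retraction \<open>r\<close> brings the rounded time back, and it fixes
  \<open>u \<omega>\<close> itself.\<close>

lemma measurable_continuous_process:
  fixes Z :: "real \<Rightarrow> 'a \<Rightarrow> 'b :: metric_space"
  assumes r: "continuous_on UNIV r" "range r \<subseteq> I" "\<And>t. t \<in> I \<Longrightarrow> r t = t"
    and Z: "\<And>t. t \<in> I \<Longrightarrow> Z t \<in> borel_measurable N"
    and cont: "\<And>\<omega>. \<omega> \<in> space N \<Longrightarrow> continuous_on I (\<lambda>t. Z t \<omega>)"
    and u[measurable]: "u \<in> borel_measurable N" and uI: "\<And>\<omega>. \<omega> \<in> space N \<Longrightarrow> u \<omega> \<in> I"
  shows "(\<lambda>\<omega>. Z (u \<omega>) \<omega>) \<in> borel_measurable N"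
proof (rule borel_measurable_LIMSEQ_metric)
  fix i
  have "(\<lambda>\<omega>. Z (r (of_int j / real (Suc i))) \<omega>) \<in> borel_measurable N" for j
    using r(2) by (intro Z) auto
  then show "(\<lambda>\<omega>. Z (r (of_int \<lceil>real (Suc i) * u \<omega>\<rceil> / real (Suc i))) \<omega>) \<in> borel_measurable N"
    by (rule measurable_compose_countable) measurable
next
  fix \<omega> assume \<omega>: "\<omega> \<in> space N"
  have "(\<lambda>i. r (of_int \<lceil>real (Suc i) * u \<omega>\<rceil> / real (Suc i))) \<longlonglongrightarrow> r (u \<omega>)"
    by (rule continuous_on_tendsto_compose[OF r(1) LIMSEQ_ceiling_grid]) simp_all
  then show "(\<lambda>i. Z (r (of_int \<lceil>real (Suc i) * u \<omega>\<rceil> / real (Suc i))) \<omega>) \<longlonglongrightarrow> Z (u \<omega>) \<omega>"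
    unfolding r(3)[OF uI[OF \<omega>]]
    by (rule continuous_on_tendsto_compose[OF cont[OF \<omega>] _ uI[OF \<omega>]])
       (use r(2) in \<open>simp add: image_subset_iff del: of_nat_Suc\<close>)
qed

section \<open>Second moments of affine functions of an increment\<close>

text \<open>Both integrals are sums over the level sets of \<open>c\<close>. With \<open>c\<close>
  listing the values of rounded random times, these times become constants on each cell.\<close>

lemma nn_integral_mono_countable_partition:
  fixes c :: "'a \<Rightarrow> 'i :: countable" and u v :: "'a \<Rightarrow> ennreal"
  assumes [measurable]: "u \<in> borel_measurable M" "v \<in> borel_measurable M"
      "c \<in> measurable M (count_space UNIV)"
    and le: "\<And>i. (\<integral>\<^sup>+\<omega>. u \<omega> * indicator (c -` {i}) \<omega> \<partial>M) \<le> (\<integral>\<^sup>+\<omega>. v \<omega> * indicator (c -` {i}) \<omega> \<partial>M)"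
  shows "(\<integral>\<^sup>+\<omega>. u \<omega> \<partial>M) \<le> (\<integral>\<^sup>+\<omega>. v \<omega> \<partial>M)"
proof -
  have split: "(\<integral>\<^sup>+\<omega>. w \<omega> \<partial>M) = (\<Sum>n. \<integral>\<^sup>+\<omega>. w \<omega> * indicator {\<omega>. to_nat (c \<omega>) = n} \<omega> \<partial>M)"
    if [measurable]: "w \<in> borel_measurable M" for w :: "'a \<Rightarrow> ennreal"
  proof -
    have "w \<omega> = (\<Sum>n. w \<omega> * indicator {\<omega>. to_nat (c \<omega>) = n} \<omega>)" for \<omega>
      by (subst suminf_finite[of "{to_nat (c \<omega>)}"]) (auto simp: indicator_def)
    then have "(\<integral>\<^sup>+\<omega>. w \<omega> \<partial>M) = (\<integral>\<^sup>+\<omega>. (\<Sum>n. w \<omega> * indicator {\<omega>. to_nat (c \<omega>) = n} \<omega>) \<partial>M)"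
      by simp
    also have "\<dots> = (\<Sum>n. \<integral>\<^sup>+\<omega>. w \<omega> * indicator {\<omega>. to_nat (c \<omega>) = n} \<omega> \<partial>M)"
      by (intro nn_integral_suminf) measurable
    finally show ?thesis .
  qed
  have "(\<integral>\<^sup>+\<omega>. u \<omega> * indicator {\<omega>. to_nat (c \<omega>) = n} \<omega> \<partial>M)
      \<le> (\<integral>\<^sup>+\<omega>. v \<omega> * indicator {\<omega>. to_nat (c \<omega>) = n} \<omega> \<partial>M)" for n
  proof (cases "\<exists>i::'i. to_nat i = n")
    case True
    then obtain i :: 'i where "to_nat i = n" by blast
    then have "{\<omega>. to_nat (c \<omega>) = n} = c -` {i}" by auto
    then show ?thesis using le[of i] by simp
  next
    case False
    then have "{\<omega>. to_nat (c \<omega>) = n} = {}" by auto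
    then show ?thesis by simp
  qed
  then show ?thesis
    unfolding split[OF assms(1)] split[OF assms(2)] by (intro suminf_le) auto
qed

lemma integrable_normal_distributed:
  assumes X: "distributed M lborel X (normal_density 0 \<sigma>)" and \<sigma>: "\<sigma> > 0"
  shows "integrable M X" "integral\<^sup>L M X = 0"
    "integrable M (\<lambda>\<omega>. (X \<omega>)\<^sup>2)" "integral\<^sup>L M (\<lambda>\<omega>. (X \<omega>)\<^sup>2) = \<sigma>\<^sup>2"
proof -
  note d = distributed_integrable[OF X] distributed_integral[OF X]
  show "integrable M X"
    using d(1)[of "\<lambda>x. x"] integrable_normal_moment[OF \<sigma>, of 0 1]
    by (simp add: normal_density_nonneg)
  show "integral\<^sup>L M X = 0"
    using d(2)[of "\<lambda>x. x"] integral_normal_moment_odd[OF \<sigma>, of 0 0]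
    by (simp add: normal_density_nonneg)
  show "integrable M (\<lambda>\<omega>. (X \<omega>)\<^sup>2)"
    using d(1)[of "\<lambda>x. x\<^sup>2"] integrable_normal_moment[OF \<sigma>, of 0 2]
    by (simp add: normal_density_nonneg)
  show "integral\<^sup>L M (\<lambda>\<omega>. (X \<omega>)\<^sup>2) = \<sigma>\<^sup>2"
    using d(2)[of "\<lambda>x. x\<^sup>2"] integral_normal_moment_even[OF \<sigma>, of 0 1]
    by (simp add: normal_density_nonneg power2_eq_square)
qed

text \<open>In the expanded square the linear term has mean zero, and the quadratic term is at most
  the squared norm of \<open>B\<close> times the squared norm of \<open>D\<close>, whose mean is d
  r.\<close>

lemma (in prob_space) nn_integral_norm_affine_le:
  fixes D :: "'a \<Rightarrow> real ^ 'd" and a :: "real ^ 'm" and B :: "real ^ 'd ^ 'm"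
  assumes D: "\<And>i. integrable M (\<lambda>\<omega>. D \<omega> $ i)" "\<And>i. expectation (\<lambda>\<omega>. D \<omega> $ i) = 0"
    and D2: "\<And>i. integrable M (\<lambda>\<omega>. (D \<omega> $ i)\<^sup>2)" "\<And>i. expectation (\<lambda>\<omega>. (D \<omega> $ i)\<^sup>2) = r"
  shows "(\<integral>\<^sup>+\<omega>. ennreal ((norm (a + B *v D \<omega>))\<^sup>2) \<partial>M)
    \<le> ennreal ((norm a)\<^sup>2 + real CARD('d) * r * (norm B)\<^sup>2)"
proof -
  define b where "b = transpose B *v a"
  define Q where "Q \<omega> = (norm a)\<^sup>2 + 2 * (\<Sum>i\<in>UNIV. b $ i * D \<omega> $ i) + (norm B)\<^sup>2 * (\<Sum>i\<in>UNIV. (D \<omega> $ i)\<^sup>2)" for \<omega>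
  have le: "(norm (a + B *v D \<omega>))\<^sup>2 \<le> Q \<omega>" for \<omega>
  proof -
    have "(norm (a + B *v D \<omega>))\<^sup>2 = (norm a)\<^sup>2 + 2 * (a \<bullet> (B *v D \<omega>)) + (norm (B *v D \<omega>))\<^sup>2"
      by (simp add: power2_norm_eq_inner inner_add_left inner_add_right inner_commute)
    also have "a \<bullet> (B *v D \<omega>) = b \<bullet> D \<omega>"
      by (simp add: b_def dot_lmul_matrix)
    also have "\<dots> = (\<Sum>i\<in>UNIV. b $ i * D \<omega> $ i)"
      by (simp add: inner_vec_def)
    also have "(norm (B *v D \<omega>))\<^sup>2 \<le> (norm B * norm (D \<omega>))\<^sup>2"
      by (intro power_mono norm_matrix_vector_mult_le) auto
    also have "\<dots> = (norm B)\<^sup>2 * (\<Sum>i\<in>UNIV. (D \<omega> $ i)\<^sup>2)"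
      by (simp add: power_mult_distrib norm_vec_def L2_set_def sum_nonneg)
    finally show ?thesis by (simp add: Q_def)
  qed
  have int: "integrable M Q" unfolding Q_def using D(1) D2(1) by auto
  have "expectation Q = (norm a)\<^sup>2 + real CARD('d) * r * (norm B)\<^sup>2"
    unfolding Q_def using D D2 by (simp add: prob_space)
  moreover have "(\<integral>\<^sup>+\<omega>. ennreal ((norm (a + B *v D \<omega>))\<^sup>2) \<partial>M) \<le> (\<integral>\<^sup>+\<omega>. ennreal (Q \<omega>) \<partial>M)"
    by (intro nn_integral_mono ennreal_leI le)
  \<comment> \<open>\<open>Q\<close> contains terms of either sign but dominates a square, so it is
    nonnegative as a whole and \<open>ennreal\<close> truncates nothing.\<close>
  moreover have "(\<integral>\<^sup>+\<omega>. ennreal (Q \<omega>) \<partial>M) = ennreal (expectation Q)"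
    using le by (intro nn_integral_eq_integral int AE_I2) (meson order_trans zero_le_power2)
  ultimately show ?thesis by simp
qed

text \<open>By independence the joint law of \<open>(a, B)\<close> and \<open>D\<close> is a
  product. Tonelli then leaves an inner integral over \<open>D\<close> with constant coefficients,
  where the previous bound applies.\<close>

lemma (in prob_space) nn_integral_norm_affine_indep_le:
  fixes D :: "'a \<Rightarrow> real ^ 'd" and a :: "'a \<Rightarrow> real ^ 'm" and B :: "'a \<Rightarrow> real ^ 'd ^ 'm"
  assumes D: "\<And>i. integrable M (\<lambda>\<omega>. D \<omega> $ i)" "\<And>i. expectation (\<lambda>\<omega>. D \<omega> $ i) = 0"
    and D2: "\<And>i. integrable M (\<lambda>\<omega>. (D \<omega> $ i)\<^sup>2)" "\<And>i. expectation (\<lambda>\<omega>. (D \<omega> $ i)\<^sup>2) = r"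
    and D_meas[measurable]: "D \<in> borel_measurable M"
    and G: "subalgebra M G"
    and ind: "indep_set (sets G) (sets (vimage_algebra (space M) D borel))"
    and aB: "a \<in> borel_measurable G" "B \<in> borel_measurable G"
  shows "(\<integral>\<^sup>+\<omega>. ennreal ((norm (a \<omega> + B \<omega> *v D \<omega>))\<^sup>2) \<partial>M)
    \<le> (\<integral>\<^sup>+\<omega>. ennreal ((norm (a \<omega>))\<^sup>2 + real CARD('d) * r * (norm (B \<omega>))\<^sup>2) \<partial>M)"
proof -
  let ?A = "\<lambda>\<omega>. (a \<omega>, B \<omega>)"
  have A_G: "?A \<in> borel_measurable G" using aB by measurable
  have [measurable]: "?A \<in> borel_measurable M"
    using measurable_from_subalg[OF G A_G] .
  interpret A: prob_space "distr M borel ?A" by (rule prob_space_distr) simp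
  interpret D: prob_space "distr M borel D" by (rule prob_space_distr) simp
  have meas[measurable]: "(\<lambda>z. (norm (fst (fst z) + snd (fst z) *v snd z))\<^sup>2)
    \<in> borel_measurable ((borel :: ((real ^ 'm) \<times> (real ^ 'd ^ 'm)) measure) \<Otimes>\<^sub>M borel)"
    unfolding borel_prod[symmetric] by measurable
  have [measurable]: "(\<lambda>(a :: real ^ 'm, B :: real ^ 'd ^ 'm).
      ennreal ((norm a)\<^sup>2 + real CARD('d) * r * (norm B)\<^sup>2)) \<in> borel_measurable borel"
    unfolding borel_prod[symmetric] split_beta' by measurable
  have joint: "distr M borel ?A \<Otimes>\<^sub>M distr M borel D = distr M (borel \<Otimes>\<^sub>M borel) (\<lambda>\<omega>. (?A \<omega>, D \<omega>))"
  proof (rule pair_measure_eqI)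
    fix S T assume "S \<in> sets (distr M borel ?A)" "T \<in> sets (distr M borel D)"
    then have [measurable]: "S \<in> sets borel" "T \<in> sets borel" by auto
    have "?A -` S \<inter> space M \<in> sets G"
      using measurable_sets[OF A_G, of S] G by (simp add: subalgebra_def)
    moreover have "D -` T \<inter> space M \<in> sets (vimage_algebra (space M) D borel)"
      by (intro in_vimage_algebra) simp
    ultimately have "prob ((?A -` S \<inter> space M) \<inter> (D -` T \<inter> space M))
      = prob (?A -` S \<inter> space M) * prob (D -` T \<inter> space M)"
      by (rule indep_setD[OF ind])
    moreover have "(\<lambda>\<omega>. (?A \<omega>, D \<omega>)) -` (S \<times> T) \<inter> space M = (?A -` S \<inter> space M) \<inter> (D -` T \<inter> space M)"
      by auto
    ultimately show "emeasure (distr M borel ?A) S * emeasure (distr M borel D) T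
        = emeasure (distr M (borel \<Otimes>\<^sub>M borel) (\<lambda>\<omega>. (?A \<omega>, D \<omega>))) (S \<times> T)"
      by (simp add: emeasure_distr emeasure_eq_measure ennreal_mult'')
  qed (simp_all add: A.sigma_finite_measure_axioms D.sigma_finite_measure_axioms cong: sets_pair_measure_cong)
  have "(\<integral>\<^sup>+\<omega>. ennreal ((norm (a \<omega> + B \<omega> *v D \<omega>))\<^sup>2) \<partial>M)
    = (\<integral>\<^sup>+z. (\<lambda>((a, B), w). ennreal ((norm (a + B *v w))\<^sup>2)) z
        \<partial>distr M (borel \<Otimes>\<^sub>M borel) (\<lambda>\<omega>. (?A \<omega>, D \<omega>)))"
    by (subst nn_integral_distr) (auto simp: split_beta')
  also have "\<dots> = (\<integral>\<^sup>+z. (\<lambda>((a, B), w). ennreal ((norm (a + B *v w))\<^sup>2)) z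
      \<partial>(distr M borel ?A \<Otimes>\<^sub>M distr M borel D))"
    by (simp only: joint)
  also have "\<dots> = (\<integral>\<^sup>+(a, B). \<integral>\<^sup>+w. ennreal ((norm (a + B *v w))\<^sup>2) \<partial>distr M borel D \<partial>distr M borel ?A)"
    by (subst D.nn_integral_fst[symmetric])
       (simp_all add: split_beta' meas cong: measurable_cong_sets sets_pair_measure_cong)
  also have "\<dots> \<le> (\<integral>\<^sup>+(a, B). ennreal ((norm a)\<^sup>2 + real CARD('d) * r * (norm B)\<^sup>2) \<partial>distr M borel ?A)"
  proof (intro nn_integral_mono, safe)
    fix a :: "real ^ 'm" and B :: "real ^ 'd ^ 'm"
    show "(\<integral>\<^sup>+w. ennreal ((norm (a + B *v w))\<^sup>2) \<partial>distr M borel D)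
      \<le> ennreal ((norm a)\<^sup>2 + real CARD('d) * r * (norm B)\<^sup>2)"
      by (subst nn_integral_distr) (auto intro!: nn_integral_norm_affine_le D D2)
  qed
  also have "\<dots> = (\<integral>\<^sup>+\<omega>. ennreal ((norm (a \<omega>))\<^sup>2 + real CARD('d) * r * (norm (B \<omega>))\<^sup>2) \<partial>M)"
    by (subst nn_integral_distr) auto
  finally show ?thesis .
qed

text \<open>The moment bound for deterministic times extends to a random time \<open>T\<close> and a random step \<open>H\<close>
  known at \<open>T\<close>: round \<open>T\<close> up and \<open>H\<close> down to multiples of \<open>1 / i\<close>, split according to the countably
  many values, and use Fatou's lemma. As the bound is for the whole square rather than for the
  separate terms of its expansion, no integrability of the cross term is needed.\<close>

lemma nn_integral_norm_affine_random_time_le: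
  fixes W :: "real \<Rightarrow> 'a \<Rightarrow> real ^ 'd" and a :: "'a \<Rightarrow> real ^ 'm" and B :: "'a \<Rightarrow> real ^ 'd ^ 'm"
  assumes F: "\<And>t. 0 \<le> t \<Longrightarrow> subalgebra M (F t)"
    and W: "\<And>t. 0 \<le> t \<Longrightarrow> W t \<in> borel_measurable M"
    and cont: "\<And>\<omega>. continuous_on {0..} (\<lambda>t. W t \<omega>)"
    and moment: "\<And>s r (a :: 'a \<Rightarrow> real ^ 'm) (B :: 'a \<Rightarrow> real ^ 'd ^ 'm). 0 \<le> s \<Longrightarrow> 0 \<le> r \<Longrightarrow>
      a \<in> borel_measurable (F s) \<Longrightarrow> B \<in> borel_measurable (F s) \<Longrightarrow>
      (\<integral>\<^sup>+\<omega>. ennreal ((norm (a \<omega> + B \<omega> *v (W (s + r) \<omega> - W s \<omega>)))\<^sup>2) \<partial>M)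
        \<le> (\<integral>\<^sup>+\<omega>. ennreal ((norm (a \<omega>))\<^sup>2 + real CARD('d) * r * (norm (B \<omega>))\<^sup>2) \<partial>M)"
    and TH: "\<And>\<omega>. 0 \<le> T \<omega>" "\<And>\<omega>. 0 \<le> H \<omega>"
    and meas[measurable]: "T \<in> borel_measurable M" "H \<in> borel_measurable M"
      "a \<in> borel_measurable M" "B \<in> borel_measurable M"
    and T: "\<And>q. 0 \<le> q \<Longrightarrow> {\<omega> \<in> space M. T \<omega> \<le> q} \<in> sets (F q)"
    and known:
      "\<And>q. 0 \<le> q \<Longrightarrow> T \<in> borel_measurable (restrict_space (F q) {\<omega> \<in> space M. T \<omega> \<le> q})"
      "\<And>q. 0 \<le> q \<Longrightarrow> H \<in> borel_measurable (restrict_space (F q) {\<omega> \<in> space M. T \<omega> \<le> q})"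
      "\<And>q. 0 \<le> q \<Longrightarrow> a \<in> borel_measurable (restrict_space (F q) {\<omega> \<in> space M. T \<omega> \<le> q})"
      "\<And>q. 0 \<le> q \<Longrightarrow> B \<in> borel_measurable (restrict_space (F q) {\<omega> \<in> space M. T \<omega> \<le> q})"
  shows "(\<integral>\<^sup>+\<omega>. ennreal ((norm (a \<omega> + B \<omega> *v (W (T \<omega> + H \<omega>) \<omega> - W (T \<omega>) \<omega>)))\<^sup>2) \<partial>M)
    \<le> (\<integral>\<^sup>+\<omega>. ennreal ((norm (a \<omega>))\<^sup>2 + real CARD('d) * H \<omega> * (norm (B \<omega>))\<^sup>2) \<partial>M)"
    (is "(\<integral>\<^sup>+\<omega>. ?u \<omega> \<partial>M) \<le> (\<integral>\<^sup>+\<omega>. ?v \<omega> \<partial>M)")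
proof -
  have W_at[measurable]: "(\<lambda>\<omega>. W (t \<omega>) \<omega>) \<in> borel_measurable M"
    if "t \<in> borel_measurable M" "\<And>\<omega>. 0 \<le> t \<omega>" for t
    by (rule measurable_continuous_process[where r = "max 0" and I = "{0..}"])
       (use that in \<open>auto intro!: continuous_intros W cont\<close>)
  define Ti where "Ti i \<omega> = of_int \<lceil>real (Suc i) * T \<omega>\<rceil> / real (Suc i)" for i \<omega>
  define Hi where "Hi i \<omega> = of_int \<lfloor>real (Suc i) * H \<omega>\<rfloor> / real (Suc i)" for i \<omega>
  define U where "U i \<omega> = ennreal ((norm (a \<omega> + B \<omega> *v (W (Ti i \<omega> + Hi i \<omega>) \<omega> - W (Ti i \<omega>) \<omega>)))\<^sup>2)" for i \<omega>
  have grid0: "0 \<le> \<lceil>real (Suc i) * T \<omega>\<rceil>" "0 \<le> \<lfloor>real (Suc i) * H \<omega>\<rfloor>" for i \<omega>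
  proof -
    have "0 \<le> real (Suc i) * T \<omega>" "0 \<le> real (Suc i) * H \<omega>" using TH[of \<omega>] by auto
    then show "0 \<le> \<lceil>real (Suc i) * T \<omega>\<rceil>" "0 \<le> \<lfloor>real (Suc i) * H \<omega>\<rfloor>" by linarith+
  qed
  then have Ti0: "0 \<le> Ti i \<omega>" and Hi0: "0 \<le> Hi i \<omega>" for i \<omega>
    by (simp_all add: Ti_def Hi_def del: of_nat_Suc)
  have [measurable]: "Ti i \<in> borel_measurable M" "Hi i \<in> borel_measurable M" for i
    unfolding Ti_def Hi_def by measurable
  have U_meas[measurable]: "U i \<in> borel_measurable M" for i
    unfolding U_def using Ti0 Hi0 by (auto intro!: measurable_compose[OF _ measurable_ennreal]
      borel_measurable_power borel_measurable_norm borel_measurable_add borel_measurable_diff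
      borel_measurable_matrix_vector_mult W_at)
  have U_le: "(\<integral>\<^sup>+\<omega>. U i \<omega> \<partial>M) \<le> (\<integral>\<^sup>+\<omega>. ?v \<omega> \<partial>M)" for i
  proof (rule nn_integral_mono_countable_partition)
    let ?c = "\<lambda>\<omega>. (\<lceil>real (Suc i) * T \<omega>\<rceil>, \<lfloor>real (Suc i) * H \<omega>\<rfloor>)"
    show "?c \<in> measurable M (count_space UNIV)"
      by measurable
    fix pj :: "int \<times> int"
    obtain p j where pj: "pj = (p, j)" by (cases pj)
    let ?q = "of_int p / real (Suc i)" and ?r = "of_int j / real (Suc i)"
    show "(\<integral>\<^sup>+\<omega>. U i \<omega> * indicator (?c -` {pj}) \<omega> \<partial>M) \<le> (\<integral>\<^sup>+\<omega>. ?v \<omega> * indicator (?c -` {pj}) \<omega> \<partial>M)"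
    proof (cases "0 \<le> p \<and> 0 \<le> j")
      case False
      with grid0[of i] have "?c -` {pj} = {}" by (auto simp: pj simp del: of_nat_Suc)
      then show ?thesis by simp
    next
      case True
      then have q: "0 \<le> ?q" and r: "0 \<le> ?r" by auto
      let ?S = "{\<omega> \<in> space M. ?c \<omega> = pj}" and ?Q = "{\<omega> \<in> space M. T \<omega> \<le> ?q}"
      \<comment> \<open>This is why \<open>T\<close> is rounded up: on the cell \<open>T\<close> is
        at most the grid value \<open>?q\<close>, so the cell is an event of \<open>F ?q\<close> and
        the coefficients are known there at time \<open>?q\<close>.\<close>
      have S_T: "T \<omega> \<le> ?q" if "\<omega> \<in> ?S" for \<omega>
        using that by (auto simp: pj pos_le_divide_eq mult.commute simp del: of_nat_Suc)
      note [measurable] = known[OF q]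
      have space_F: "space (F ?q) = space M" using F[OF q] by (simp add: subalgebra_def)
      have "{\<omega> \<in> space (restrict_space (F ?q) ?Q). ?c \<omega> = pj} \<in> sets (restrict_space (F ?q) ?Q)"
        by measurable
      moreover have "{\<omega> \<in> space (restrict_space (F ?q) ?Q). ?c \<omega> = pj} = ?S"
        using S_T by (auto simp: space_restrict_space space_F simp del: of_nat_Suc)
      moreover have "?Q \<inter> space (F ?q) \<in> sets (F ?q)"
        using T[OF q] by (auto simp: space_F)
      ultimately have S: "?S \<in> sets (F ?q)"
        by (metis (no_types, lifting) sets_restrict_space_iff)
      \<comment> \<open>Data known on the cell only become \<open>F ?q\<close>-measurable on the
        whole space when extended by zero; off the cell both integrands of the moment bound then
        vanish.\<close>
      have ext: "(\<lambda>\<omega>. indicator ?S \<omega> *\<^sub>R z \<omega>) \<in> borel_measurable (F ?q)"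
        if "z \<in> borel_measurable (restrict_space (F ?q) ?Q)" for z :: "'a \<Rightarrow> 'z :: real_normed_vector"
      proof (subst borel_measurable_restrict_space_iff[symmetric])
        show "?S \<inter> space (F ?q) \<in> sets (F ?q)" using S by (auto simp: space_F)
        have "z \<in> borel_measurable (restrict_space (restrict_space (F ?q) ?Q) ?S)"
          using that by (rule measurable_restrict_space1)
        moreover have "restrict_space (restrict_space (F ?q) ?Q) ?S = restrict_space (F ?q) (?Q \<inter> ?S)"
          using T[OF q] S sets.Int_space_eq2[OF T[OF q]] sets.Int_space_eq2[OF S]
          by (intro restrict_restrict_space) (simp_all only:)
        moreover have "?Q \<inter> ?S = ?S" using S_T by auto
        ultimately show "z \<in> borel_measurable (restrict_space (F ?q) ?S)"
          by (simp only:)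
      qed
      let ?a = "\<lambda>\<omega>. indicator ?S \<omega> *\<^sub>R a \<omega>" and ?B = "\<lambda>\<omega>. indicator ?S \<omega> *\<^sub>R B \<omega>"
      have "(\<integral>\<^sup>+\<omega>. U i \<omega> * indicator (?c -` {pj}) \<omega> \<partial>M)
        = (\<integral>\<^sup>+\<omega>. ennreal ((norm (?a \<omega> + ?B \<omega> *v (W (?q + ?r) \<omega> - W ?q \<omega>)))\<^sup>2) \<partial>M)"
        by (intro nn_integral_cong) (auto simp: U_def Ti_def Hi_def pj indicator_def simp del: of_nat_Suc)
      also have "\<dots> \<le> (\<integral>\<^sup>+\<omega>. ennreal ((norm (?a \<omega>))\<^sup>2 + real CARD('d) * ?r * (norm (?B \<omega>))\<^sup>2) \<partial>M)"
        by (intro moment q r ext known[OF q])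
      also have "\<dots> \<le> (\<integral>\<^sup>+\<omega>. ?v \<omega> * indicator (?c -` {pj}) \<omega> \<partial>M)"
      proof (intro nn_integral_mono)
        fix \<omega> assume \<omega>: "\<omega> \<in> space M"
        show "ennreal ((norm (?a \<omega>))\<^sup>2 + real CARD('d) * ?r * (norm (?B \<omega>))\<^sup>2) \<le> ?v \<omega> * indicator (?c -` {pj}) \<omega>"
        proof (cases "\<omega> \<in> ?S")
          case True
          \<comment> \<open>This is why \<open>H\<close> is rounded down: the variance over the grid
            step stays below the claimed one.\<close>
          then have "of_int j \<le> real (Suc i) * H \<omega>" by (auto simp: pj simp del: of_nat_Suc)
          then have "?r \<le> H \<omega>" by (simp add: pos_divide_le_eq mult.commute del: of_nat_Suc)
          then have "real CARD('d) * ?r * (norm (B \<omega>))\<^sup>2 \<le> real CARD('d) * H \<omega> * (norm (B \<omega>))\<^sup>2"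
            by (intro mult_right_mono mult_left_mono) auto
          then show ?thesis using True by (auto intro!: ennreal_leI)
        qed simp
      qed
      finally show ?thesis .
    qed
  qed (simp_all add: U_meas)
  have "(\<lambda>i. U i \<omega>) \<longlonglongrightarrow> ?u \<omega>" for \<omega>
  proof -
    have T_lim: "(\<lambda>i. Ti i \<omega>) \<longlonglongrightarrow> T \<omega>" and H_lim: "(\<lambda>i. Hi i \<omega>) \<longlonglongrightarrow> H \<omega>"
      unfolding Ti_def Hi_def by (rule LIMSEQ_ceiling_grid LIMSEQ_floor_grid)+
    have "(\<lambda>i. W (Ti i \<omega> + Hi i \<omega>) \<omega>) \<longlonglongrightarrow> W (T \<omega> + H \<omega>) \<omega>" "(\<lambda>i. W (Ti i \<omega>) \<omega>) \<longlonglongrightarrow> W (T \<omega>) \<omega>"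
      using TH[of \<omega>] Ti0 Hi0
      by (auto intro!: continuous_on_tendsto_compose[OF cont] tendsto_add T_lim H_lim)
    moreover have "isCont (\<lambda>x. B \<omega> *v x) x" for x :: "real ^ 'd"
      by (intro linear_continuous_at matrix_vector_mul_bounded_linear)
    ultimately show ?thesis
      unfolding U_def
      by (intro tendsto_ennrealI tendsto_power tendsto_norm tendsto_add tendsto_const
          isCont_tendsto_compose[of _ "\<lambda>x. B \<omega> *v x"] tendsto_diff)
  qed
  then have "?u \<omega> = liminf (\<lambda>i. U i \<omega>)" for \<omega>
    by (intro lim_imp_Liminf[symmetric]) auto
  then have "(\<integral>\<^sup>+\<omega>. ?u \<omega> \<partial>M) \<le> liminf (\<lambda>i. \<integral>\<^sup>+\<omega>. U i \<omega> \<partial>M)"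
    by (simp add: nn_integral_liminf)
  also have "\<dots> \<le> (\<integral>\<^sup>+\<omega>. ?v \<omega> \<partial>M)"
    by (intro Liminf_le always_eventually allI U_le) simp
  finally show ?thesis .
qed

section \<open>Measurability of the scheme\<close>

text \<open>The sigma-algebra \<open>N\<close> is kept abstract so that the lemma serves both \<open>M\<close> and the restriction of
  \<open>F q\<close> to the event \<open>t\<^sub>n \<le> q\<close>, on which the path of \<open>W\<close> is only known up to time \<open>q\<close>.\<close>

lemma scheme_measurable:
  fixes h :: "real ^ 'm \<Rightarrow> real" and f :: "real ^ 'm \<Rightarrow> real ^ 'm \<Rightarrow> real ^ 'm"
    and g :: "real ^ 'm \<Rightarrow> real ^ 'm \<Rightarrow> real ^ 'd ^ 'm"
    and \<tau> :: real and \<xi> :: "'a \<Rightarrow> real \<Rightarrow> real ^ 'm" and W :: "real \<Rightarrow> 'a \<Rightarrow> real ^ 'd"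
  defines "st n \<omega> \<equiv> scheme_state h f g \<tau> (\<xi> \<omega>) (\<lambda>t. W t \<omega>) n"
  assumes h_pos: "\<And>x. 0 < h x" and \<tau>: "0 < \<tau>"
    and [measurable]: "h \<in> borel_measurable borel"
      "case_prod f \<in> borel_measurable borel" "case_prod g \<in> borel_measurable borel"
    and \<xi>: "\<forall>v \<in> borel_measurable N. (\<forall>\<omega> \<in> space N. - \<tau> \<le> v \<omega> \<and> v \<omega> \<le> 0) \<longrightarrow>
      (\<lambda>\<omega>. \<xi> \<omega> (v \<omega>)) \<in> borel_measurable N"
    and W: "\<forall>u \<in> borel_measurable N. (\<forall>\<omega> \<in> space N. 0 \<le> u \<omega> \<and> u \<omega> \<le> fst (st n \<omega>)) \<longrightarrow>
      (\<lambda>\<omega>. W (u \<omega>) \<omega>) \<in> borel_measurable N"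
  shows "(\<lambda>\<omega>. fst (st n \<omega>)) \<in> borel_measurable N \<and>
    (\<forall>s \<in> borel_measurable N. (\<forall>\<omega> \<in> space N. - \<tau> \<le> s \<omega>) \<longrightarrow> (\<lambda>\<omega>. snd (st n \<omega>) (s \<omega>)) \<in> borel_measurable N)"
  using W
proof (induction n)
  case 0
  \<comment> \<open>State 0 is \<open>\<xi>\<close> frozen from time 0 on, so its argument is capped
    at 0 to stay where \<open>\<xi>\<close> is controlled.\<close>
  have "(\<lambda>\<omega>. \<xi> \<omega> (min (s \<omega>) 0)) \<in> borel_measurable N"
    if [measurable]: "s \<in> borel_measurable N" and "\<forall>\<omega> \<in> space N. - \<tau> \<le> s \<omega>" for s
    using that(2) \<tau> by (intro \<xi>[rule_format]) auto
  moreover have "snd (st 0 \<omega>) s = \<xi> \<omega> (min s 0)" for \<omega> s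
    by (simp add: st_def min_def)
  ultimately show ?case by (simp add: st_def)
next
  case (Suc n)
  define t where "t \<omega> = fst (st n \<omega>)" for \<omega>
  define X where "X \<omega> = snd (st n \<omega>) (t \<omega>)" for \<omega>
  define Y where "Y \<omega> = snd (st n \<omega>) (t \<omega> - \<tau>)" for \<omega>
  define t' where "t' \<omega> = t \<omega> + h (X \<omega>)" for \<omega>
  define X' where "X' \<omega> = X \<omega> + h (X \<omega>) *\<^sub>R f (X \<omega>) (Y \<omega>) + g (X \<omega>) (Y \<omega>) *v (W (t' \<omega>) \<omega> - W (t \<omega>) \<omega>)" for \<omega>
  have st_Suc: "st (Suc n) \<omega> = (t' \<omega>, \<lambda>s. if s < t' \<omega> then snd (st n \<omega>) s else X' \<omega>)" for \<omega>
    by (simp add: st_def t_def X_def Y_def t'_def X'_def Let_def split_beta cong: if_cong)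
  have t0: "0 \<le> t \<omega>" for \<omega>
  proof -
    have "strict_mono (scheme_time h f g \<tau> (\<xi> \<omega>) (\<lambda>t. W t \<omega>))"
      by (rule strict_mono_scheme_time[OF h_pos])
    then have "scheme_time h f g \<tau> (\<xi> \<omega>) (\<lambda>t. W t \<omega>) 0 \<le> scheme_time h f g \<tau> (\<xi> \<omega>) (\<lambda>t. W t \<omega>) n"
      by (simp add: strict_mono_less_eq)
    then show ?thesis by (simp add: t_def st_def scheme_time_def)
  qed
  have tt': "t \<omega> \<le> t' \<omega>" for \<omega> by (simp add: t'_def h_pos less_imp_le)
  \<comment> \<open>The hypothesis on \<open>W\<close> depends on \<open>n\<close> and is carried
    through the induction: times bounded by the n-th grid point are also bounded by the next
    one.\<close>
  have IH: "(\<lambda>\<omega>. fst (st n \<omega>)) \<in> borel_measurable N \<and>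
    (\<forall>s \<in> borel_measurable N. (\<forall>\<omega> \<in> space N. - \<tau> \<le> s \<omega>) \<longrightarrow> (\<lambda>\<omega>. snd (st n \<omega>) (s \<omega>)) \<in> borel_measurable N)"
  proof (rule Suc.IH, intro ballI impI)
    fix u assume "u \<in> borel_measurable N" "\<forall>\<omega> \<in> space N. 0 \<le> u \<omega> \<and> u \<omega> \<le> fst (st n \<omega>)"
    then show "(\<lambda>\<omega>. W (u \<omega>) \<omega>) \<in> borel_measurable N"
      using tt' by (intro Suc.prems[rule_format]) (auto simp: st_Suc t_def intro: order_trans)
  qed
  have t_meas[measurable]: "t \<in> borel_measurable N" using IH by (simp add: t_def[abs_def])
  have snd_meas: "(\<lambda>\<omega>. snd (st n \<omega>) (s \<omega>)) \<in> borel_measurable N"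
    if "s \<in> borel_measurable N" "\<And>\<omega>. \<omega> \<in> space N \<Longrightarrow> - \<tau> \<le> s \<omega>" for s
    using IH that by blast
  have [measurable]: "X \<in> borel_measurable N"
    unfolding X_def[abs_def] using t0 \<tau> by (intro snd_meas t_meas) (meson less_imp_le neg_le_0_iff_le order_trans)
  have [measurable]: "Y \<in> borel_measurable N"
    unfolding Y_def[abs_def] using t0 \<tau> by (intro snd_meas) auto
  have t'_meas[measurable]: "t' \<in> borel_measurable N" unfolding t'_def[abs_def] by measurable
  have [measurable]: "(\<lambda>\<omega>. W (t' \<omega>) \<omega>) \<in> borel_measurable N" "(\<lambda>\<omega>. W (t \<omega>) \<omega>) \<in> borel_measurable N"
    using t0 tt' by (auto intro!: Suc.prems[rule_format] simp: st_Suc intro: order_trans)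
  have fg[measurable]: "(\<lambda>\<omega>. f (X \<omega>) (Y \<omega>)) \<in> borel_measurable N" "(\<lambda>\<omega>. g (X \<omega>) (Y \<omega>)) \<in> borel_measurable N"
    using measurable_compose[of "\<lambda>\<omega>. (X \<omega>, Y \<omega>)" N borel "case_prod f" borel]
      measurable_compose[of "\<lambda>\<omega>. (X \<omega>, Y \<omega>)" N borel "case_prod g" borel] by auto
  have [measurable]: "X' \<in> borel_measurable N" unfolding X'_def[abs_def] by measurable
  have "(\<lambda>\<omega>. if s \<omega> < t' \<omega> then snd (st n \<omega>) (s \<omega>) else X' \<omega>) \<in> borel_measurable N"
    if [measurable]: "s \<in> borel_measurable N" and "\<forall>\<omega> \<in> space N. - \<tau> \<le> s \<omega>" for s
  proof -
    have [measurable]: "(\<lambda>\<omega>. snd (st n \<omega>) (s \<omega>)) \<in> borel_measurable N"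
      using that by (intro snd_meas) auto
    show ?thesis by measurable
  qed
  then show ?case by (simp add: st_Suc t'_meas)
qed

section \<open>Pathwise estimates: the sum of the delay terms and the one-step inequality\<close>

text \<open>Every step that starts in \<open>[a, b)\<close>, except the last, is covered by \<open>[a, b)\<close>; capping the
  last one by \<open>c\<close> costs at most \<open>c\<close>. Applied to the steps whose delayed argument falls into one
  fixed step of length \<open>b - a = c\<close>, this produces the factor 2 in front of \<open>\<alpha>\<^sub>2\<close>.\<close>

lemma sum_capped_increments_le:
  fixes t :: "nat \<Rightarrow> real"
  assumes "finite J" and J: "\<And>n. n \<in> J \<Longrightarrow> a \<le> t n \<and> t n < b"
    and mono: "strict_mono t" and "a \<le> b" "0 \<le> c"
  shows "(\<Sum>n\<in>J. min c (t (Suc n) - t n)) \<le> (b - a) + c"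
proof (cases "J = {}")
  case False
  let ?l = "Min J" and ?m = "Max J"
  have lm: "?l \<in> J" "?m \<in> J" "?l \<le> ?m" using False \<open>finite J\<close> by auto
  have inc: "t n < t (Suc n)" for n using mono by (simp add: strict_mono_Suc_iff)
  have "(\<Sum>n\<in>J - {?m}. min c (t (Suc n) - t n)) \<le> (\<Sum>n\<in>J - {?m}. t (Suc n) - t n)"
    by (intro sum_mono) auto
  also have "\<dots> \<le> (\<Sum>n\<in>{?l..<?m}. t (Suc n) - t n)"
  proof (intro sum_mono2)
    show "J - {?m} \<subseteq> {?l..<?m}"
      using \<open>finite J\<close> by (auto simp: order_less_le)
  qed (use inc in \<open>auto simp: less_imp_le\<close>)
  also have "\<dots> = t ?m - t ?l"
    using lm(3) by (rule sum_Suc_diff')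
  also have "\<dots> \<le> b - a" using J[OF lm(1)] J[OF lm(2)] by linarith
  finally have "(\<Sum>n\<in>J - {?m}. min c (t (Suc n) - t n)) \<le> b - a" .
  then show ?thesis
    using sum.remove[OF \<open>finite J\<close> lm(2), of "\<lambda>n. min c (t (Suc n) - t n)"] by simp
qed (use assms in auto)

lemma grid_cell_exists:
  fixes t :: "nat \<Rightarrow> real"
  assumes "t 0 \<le> s" "s < t n"
  shows "\<exists>k<n. t k \<le> s \<and> s < t (Suc k)"
  using assms
proof (induction n)
  case (Suc n)
  then show ?case by (cases "s < t n") (auto intro: less_SucI)
qed simp

context
  fixes h :: "real ^ 'm \<Rightarrow> real"
    and f :: "real ^ 'm \<Rightarrow> real ^ 'm \<Rightarrow> real ^ 'm"
    and g :: "real ^ 'm \<Rightarrow> real ^ 'm \<Rightarrow> real ^ 'd ^ 'm"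
    and \<tau> hmin hmax :: real and \<xi> :: "real \<Rightarrow> real ^ 'm" and w :: "real \<Rightarrow> real ^ 'd"
  assumes hmin: "0 < hmin" "\<And>x. hmin \<le> h x" and hmax: "\<And>x. h x \<le> hmax" and \<tau>: "\<tau> > 0"
begin

private abbreviation (input) "ts \<equiv> scheme_time h f g \<tau> \<xi> w"
private abbreviation (input) "xs \<equiv> scheme_value h f g \<tau> \<xi> w"
private abbreviation (input) "xbar \<equiv> scheme_step_process h f g \<tau> \<xi> w"
private abbreviation (input) "ys n \<equiv> xbar (ts n - \<tau>)"

private lemma h_pos: "h x > 0" using hmin by (meson less_le_trans)

lemma scheme_time_ge: "real n * hmin \<le> ts n"
proof (induction n)
  case (Suc n)
  then show ?case
    using hmin(2)[of "xs n"] by (simp add: scheme_time_Suc[OF h_pos] algebra_simps)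
qed (simp add: scheme_time_0[OF h_pos])

lemma scheme_time_nonneg: "0 \<le> ts n"
  using scheme_time_ge[of n] hmin(1) by (meson mult_nonneg_nonneg of_nat_0_le_iff less_imp_le order_trans)

lemma scheme_step_process_scheme_time: "xbar (ts n) = xs n"
  by (rule scheme_step_process_eq[OF h_pos]) (simp_all add: scheme_time_Suc[OF h_pos] h_pos)

text \<open>The steps are sorted by where their delayed time falls: \<open>?I\<close> collects those
  that read the initial segment, \<open>?J k\<close> those that read the value of cell k. The latter
  start in an interval of length \<open>h (xs k)\<close>, so their lengths capped by
  \<open>h (xs k)\<close> sum to at most twice that; the former start in [0, \<tau>).\<close>

lemma sum_delayed_le:
  assumes K: "\<And>s. -\<tau> \<le> s \<Longrightarrow> s \<le> 0 \<Longrightarrow> norm (\<xi> s) \<le> K" and \<mu>: "\<mu> \<ge> 0"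
  shows "(\<Sum>n<N. exp (\<mu> * ts (Suc n)) * (min (h (ys n)) (h (xs n)) * (norm (ys n))\<^sup>2))
    \<le> exp (\<mu> * (\<tau> + hmax)) * (\<tau> + hmax) * K\<^sup>2
      + 2 * exp (\<mu> * (\<tau> + 2 * hmax)) * (\<Sum>k<N. h (xs k) * (exp (\<mu> * ts k) * (norm (xs k))\<^sup>2))"
    (is "sum ?D _ \<le> ?C0 + 2 * ?E * (\<Sum>k<N. ?G k)")
proof -
  have mono: "strict_mono ts" by (rule strict_mono_scheme_time[OF h_pos])
  have step: "ts (Suc n) = ts n + h (xs n)" for n by (rule scheme_time_Suc[OF h_pos])
  let ?I = "{n. n < N \<and> ts n < \<tau>}" and ?J = "\<lambda>k. {n. n < N \<and> ts k \<le> ts n - \<tau> \<and> ts n - \<tau> < ts (Suc k)}"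
  have hm0: "0 \<le> hmax" using h_pos[of 0] hmax[of 0] by linarith
  have K0: "0 \<le> K" using K[of 0] \<tau> norm_ge_zero[of "\<xi> 0"] by linarith
  have pos: "0 \<le> ?D n" for n using h_pos by (simp add: less_imp_le)
  have "sum ?D ?I \<le> (\<Sum>n\<in>?I. exp (\<mu> * (\<tau> + hmax)) * K\<^sup>2 * min hmax (ts (Suc n) - ts n))"
  proof (rule sum_mono)
    fix n assume n: "n \<in> ?I"
    have "norm (ys n) \<le> K"
      using n scheme_time_nonneg[of n] K[of "ts n - \<tau>"] by (simp add: scheme_step_process_neg[OF h_pos])
    \<comment> \<open>Values from the history have no cell length, so \<open>hmax\<close> serves as
      the cap and leads to the factor \<open>\<tau> + hmax\<close>.\<close>
    moreover have "min (h (ys n)) (h (xs n)) \<le> min hmax (ts (Suc n) - ts n)"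
      using hmax by (simp add: step)
    moreover have "exp (\<mu> * ts (Suc n)) \<le> exp (\<mu> * (\<tau> + hmax))"
      using n hmax[of "xs n"] \<mu> by (simp add: step mult_left_mono)
    moreover have "0 \<le> min (h (ys n)) (h (xs n))" using h_pos by (simp add: less_imp_le)
    ultimately have "?D n \<le> exp (\<mu> * (\<tau> + hmax)) * (min hmax (ts (Suc n) - ts n) * K\<^sup>2)"
      by (intro mult_mono power_mono) auto
    then show "?D n \<le> exp (\<mu> * (\<tau> + hmax)) * K\<^sup>2 * min hmax (ts (Suc n) - ts n)"
      by (simp add: mult_ac)
  qed
  also have "\<dots> = exp (\<mu> * (\<tau> + hmax)) * K\<^sup>2 * (\<Sum>n\<in>?I. min hmax (ts (Suc n) - ts n))"
    by (simp add: sum_distrib_left)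
  also have "\<dots> \<le> exp (\<mu> * (\<tau> + hmax)) * K\<^sup>2 * ((\<tau> - 0) + hmax)"
    using \<tau> hm0 by (intro mult_left_mono sum_capped_increments_le mono) (auto simp: scheme_time_nonneg)
  finally have I: "sum ?D ?I \<le> ?C0" by (simp add: mult_ac)
  have J: "sum ?D (?J k) \<le> 2 * ?E * ?G k" for k
  proof -
    have "sum ?D (?J k) \<le> (\<Sum>n\<in>?J k. ?E * (exp (\<mu> * ts k) * (norm (xs k))\<^sup>2) * min (h (xs k)) (ts (Suc n) - ts n))"
    proof (rule sum_mono)
      fix n assume n: "n \<in> ?J k"
      have Y: "ys n = xs k"
        using n by (intro scheme_step_process_eq[OF h_pos]) auto
      \<comment> \<open>One \<open>hmax\<close> bounds the length of cell k, the other the length of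
        step n.\<close>
      have "ts (Suc n) \<le> \<tau> + 2 * hmax + ts k"
        using n hmax[of "xs n"] hmax[of "xs k"] by (simp add: step)
      then have "exp (\<mu> * ts (Suc n)) \<le> exp (\<mu> * (\<tau> + 2 * hmax + ts k))"
        using \<mu> by (simp add: mult_left_mono)
      also have "\<dots> = ?E * exp (\<mu> * ts k)"
        by (simp add: exp_add[symmetric] distrib_left)
      finally have "exp (\<mu> * ts (Suc n)) * (min (h (xs k)) (h (xs n)) * (norm (xs k))\<^sup>2)
        \<le> ?E * exp (\<mu> * ts k) * (min (h (xs k)) (h (xs n)) * (norm (xs k))\<^sup>2)"
        using h_pos by (intro mult_right_mono mult_nonneg_nonneg) (auto simp: less_imp_le)
      then show "?D n \<le> ?E * (exp (\<mu> * ts k) * (norm (xs k))\<^sup>2) * min (h (xs k)) (ts (Suc n) - ts n)"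
        by (simp add: Y step mult_ac)
    qed
    also have "\<dots> = ?E * (exp (\<mu> * ts k) * (norm (xs k))\<^sup>2) * (\<Sum>n\<in>?J k. min (h (xs k)) (ts (Suc n) - ts n))"
      by (simp add: sum_distrib_left)
    also have "\<dots> \<le> ?E * (exp (\<mu> * ts k) * (norm (xs k))\<^sup>2) * ((ts (Suc k) + \<tau>) - (ts k + \<tau>) + h (xs k))"
      using h_pos[of "xs k"]
      by (intro mult_left_mono sum_capped_increments_le mono) (auto simp: step)
    also have "\<dots> = 2 * ?E * ?G k" by (simp add: step)
    finally show ?thesis .
  qed
  \<comment> \<open>The delayed time of step n lies before 0 or in a cell k with
    \<open>k < n\<close>, so each term is counted at least once; as the terms are nonnegative, this
    gives an upper bound.\<close>
  have "?D n \<le> (if ts n < \<tau> then ?D n else 0)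
      + (\<Sum>k<N. if ts k \<le> ts n - \<tau> \<and> ts n - \<tau> < ts (Suc k) then ?D n else 0)" if "n < N" for n
  proof (cases "ts n < \<tau>")
    case True
    then show ?thesis using pos[of n] by (simp add: sum_nonneg)
  next
    case False
    then obtain k where k: "k < n" "ts k \<le> ts n - \<tau>" "ts n - \<tau> < ts (Suc k)"
      using grid_cell_exists[of ts "ts n - \<tau>" n] \<tau> by (auto simp: scheme_time_0[OF h_pos])
    have "(if ts k \<le> ts n - \<tau> \<and> ts n - \<tau> < ts (Suc k) then ?D n else 0)
        \<le> (\<Sum>k<N. if ts k \<le> ts n - \<tau> \<and> ts n - \<tau> < ts (Suc k) then ?D n else 0)"
      using k(1) that pos[of n] by (intro member_le_sum) auto
    then show ?thesis using k False by simp
  qed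
  then have "sum ?D {..<N} \<le> (\<Sum>n<N. (if ts n < \<tau> then ?D n else 0)
      + (\<Sum>k<N. if ts k \<le> ts n - \<tau> \<and> ts n - \<tau> < ts (Suc k) then ?D n else 0))"
    by (intro sum_mono) simp
  also have "\<dots> = (\<Sum>n<N. if ts n < \<tau> then ?D n else 0)
      + (\<Sum>k<N. \<Sum>n<N. if ts k \<le> ts n - \<tau> \<and> ts n - \<tau> < ts (Suc k) then ?D n else 0)"
    unfolding sum.distrib by (subst sum.swap) simp
  also have "\<dots> = sum ?D ?I + (\<Sum>k<N. sum ?D (?J k))"
    by (simp add: sum.inter_filter[symmetric] lessThan_def Collect_conj_eq[symmetric])
  also have "(\<Sum>k<N. sum ?D (?J k)) \<le> (\<Sum>k<N. 2 * ?E * ?G k)"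
    by (intro sum_mono J)
  finally show ?thesis using I by (simp add: sum_distrib_left mult_ac)
qed

text \<open>The weight lowers the dissipation rate only from \<open>2 \<alpha>1\<close> to \<open>2 \<alpha>1 - \<mu>\<close>, because
  \<open>exp (\<mu> h) (1 - \<mu> h) \<le> 1\<close>.\<close>

lemma scheme_second_moment_step_le:
  assumes S2: "\<And>x y. x \<bullet> f x y + 1 / 2 * h x * (norm (f x y))\<^sup>2 + real CARD('d) / 2 * (hs_norm (g x y))\<^sup>2
      \<le> - \<alpha>1 * (norm x)\<^sup>2 + \<alpha>2 * (min (h y) (h x) / h x) * (norm y)\<^sup>2"
    and \<mu>: "0 \<le> \<mu>" "\<mu> \<le> 2 * \<alpha>1"
  shows "exp (\<mu> * ts (Suc n)) * ((norm (xs n + h (xs n) *\<^sub>R f (xs n) (ys n)))\<^sup>2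
        + real CARD('d) * h (xs n) * (hs_norm (g (xs n) (ys n)))\<^sup>2)
      + (2 * \<alpha>1 - \<mu>) * (h (xs n) * (exp (\<mu> * ts n) * (norm (xs n))\<^sup>2))
    \<le> exp (\<mu> * ts n) * (norm (xs n))\<^sup>2
      + 2 * \<alpha>2 * (exp (\<mu> * ts (Suc n)) * (min (h (ys n)) (h (xs n)) * (norm (ys n))\<^sup>2))"
proof -
  define x y H where "x = xs n" and "y = ys n" and "H = h x"
  have H: "H > 0" by (simp add: H_def h_pos)
  have "(norm (x + H *\<^sub>R f x y))\<^sup>2 + real CARD('d) * H * (hs_norm (g x y))\<^sup>2
    = (norm x)\<^sup>2 + 2 * H * (x \<bullet> f x y + 1 / 2 * H * (norm (f x y))\<^sup>2 + real CARD('d) / 2 * (hs_norm (g x y))\<^sup>2)"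
    by (simp add: power2_norm_eq_inner inner_add_left inner_add_right inner_commute algebra_simps)
  also have "\<dots> \<le> (norm x)\<^sup>2 + 2 * H * (- \<alpha>1 * (norm x)\<^sup>2 + \<alpha>2 * (min (h y) H / H) * (norm y)\<^sup>2)"
    using S2[of x y] H by (intro add_left_mono mult_left_mono) (auto simp: H_def)
  \<comment> \<open>The factor \<open>2 * H\<close> from the expansion cancels the denominator
    \<open>h x\<close> of S2.\<close>
  also have "\<dots> = (1 - 2 * \<alpha>1 * H) * (norm x)\<^sup>2 + 2 * \<alpha>2 * (min (h y) H * (norm y)\<^sup>2)"
    using H by (simp add: field_simps)
  finally have "exp (\<mu> * ts (Suc n)) * ((norm (x + H *\<^sub>R f x y))\<^sup>2 + real CARD('d) * H * (hs_norm (g x y))\<^sup>2)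
      \<le> exp (\<mu> * ts (Suc n)) * ((1 - 2 * \<alpha>1 * H) * (norm x)\<^sup>2 + 2 * \<alpha>2 * (min (h y) H * (norm y)\<^sup>2))"
    by (intro mult_left_mono) auto
  moreover have "exp (\<mu> * ts (Suc n)) * (1 - 2 * \<alpha>1 * H) \<le> exp (\<mu> * ts n) * (1 - (2 * \<alpha>1 - \<mu>) * H)"
  proof -
    have "1 - \<mu> * H \<le> exp (- (\<mu> * H))" using exp_ge_add_one_self[of "- (\<mu> * H)"] by simp
    then have "exp (\<mu> * H) * (1 - \<mu> * H) \<le> exp (\<mu> * H) * exp (- (\<mu> * H))"
      by (intro mult_left_mono) auto
    also have "\<dots> = 1" by (simp add: exp_minus)
    finally have 1: "exp (\<mu> * H) * (1 - \<mu> * H) \<le> 1" .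
    \<comment> \<open>Write 1 - 2 \<alpha>1 H as (1 - \<mu> H) - (2 \<alpha>1 - \<mu>) H.
      Multiplying the subtracted part by exp(\<mu> H) \<ge> 1 only helps, because \<mu> \<le> 2
      \<alpha>1.\<close>
    have "1 * ((2 * \<alpha>1 - \<mu>) * H) \<le> exp (\<mu> * H) * ((2 * \<alpha>1 - \<mu>) * H)"
      using \<mu> H by (intro mult_right_mono mult_nonneg_nonneg) auto
    with 1 have "exp (\<mu> * H) * (1 - 2 * \<alpha>1 * H) \<le> 1 - (2 * \<alpha>1 - \<mu>) * H"
      by (simp add: algebra_simps)
    then have "exp (\<mu> * ts n) * (exp (\<mu> * H) * (1 - 2 * \<alpha>1 * H)) \<le> exp (\<mu> * ts n) * (1 - (2 * \<alpha>1 - \<mu>) * H)"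
      by (intro mult_left_mono) auto
    moreover have "exp (\<mu> * ts (Suc n)) = exp (\<mu> * ts n) * exp (\<mu> * H)"
      by (simp add: scheme_time_Suc[OF h_pos] H_def x_def exp_add distrib_left)
    ultimately show ?thesis by (simp add: mult.assoc)
  qed
  then have "exp (\<mu> * ts (Suc n)) * (1 - 2 * \<alpha>1 * H) * (norm x)\<^sup>2
      \<le> exp (\<mu> * ts n) * (1 - (2 * \<alpha>1 - \<mu>) * H) * (norm x)\<^sup>2"
    by (rule mult_right_mono) simp
  ultimately show ?thesis
    unfolding x_def[symmetric] y_def[symmetric] H_def[symmetric] by (simp add: algebra_simps)
qed

end

section \<open>Consequences of the hypotheses on the Brownian motion and the initial segment\<close>

lemma (in prob_space) brownian_increment_second_moment_le:
  fixes W :: "real \<Rightarrow> 'a \<Rightarrow> real ^ 'd" and a :: "'a \<Rightarrow> real ^ 'm" and B :: "'a \<Rightarrow> real ^ 'd ^ 'm"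
  assumes F: "usual_conditions M F" and W: "std_brownian_motion M F W"
    and s: "0 \<le> s" and r: "0 \<le> r"
    and aB: "a \<in> borel_measurable (F s)" "B \<in> borel_measurable (F s)"
  shows "(\<integral>\<^sup>+\<omega>. ennreal ((norm (a \<omega> + B \<omega> *v (W (s + r) \<omega> - W s \<omega>)))\<^sup>2) \<partial>M)
    \<le> (\<integral>\<^sup>+\<omega>. ennreal ((norm (a \<omega>))\<^sup>2 + real CARD('d) * r * (norm (B \<omega>))\<^sup>2) \<partial>M)"
\<comment> \<open>The law of an increment is specified for strictly ordered times only; for
  \<open>r = 0\<close> the increment is zero and both sides agree.\<close>
proof (cases "r = 0")
  case False
  with r have r: "0 < r" by simp
  have sub: "subalgebra M (F t)" if "0 \<le> t" for t
    using F that by (simp add: usual_conditions_def)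
  have [measurable]: "W t \<in> borel_measurable M" if "0 \<le> t" for t
    using W that by (intro measurable_from_subalg[OF sub[OF that]]) (simp add: std_brownian_motion_def)
  have inc: "indep_set (sets (F s)) (sets (vimage_algebra (space M) (\<lambda>\<omega>. W (s + r) \<omega> - W s \<omega>) borel))"
    "\<And>i. distributed M lborel (\<lambda>\<omega>. (W (s + r) \<omega> - W s \<omega>) $ i) (normal_density 0 (sqrt r))"
    using W[unfolded std_brownian_motion_def, THEN conjunct2, THEN conjunct2, THEN conjunct2,
        rule_format, of s "s + r"] s r
    by simp_all
  have "0 < sqrt r" using r by simp
  note n = integrable_normal_distributed[OF inc(2) this]
  show ?thesis
    using n(4) r s
    by (intro nn_integral_norm_affine_indep_le[OF n(1-3) _ _ sub[OF s] inc(1) aB]) simp_all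
qed simp

text \<open>The paths are set to zero on a null set that contains the discontinuous ones. Null sets
  belong to \<open>F 0\<close>, so the modification stays adapted; it agrees with \<open>W\<close>
  at all times simultaneously, so almost surely both drive the same scheme.\<close>

lemma brownian_motion_continuous_version:
  assumes F: "usual_conditions M F" and W: "std_brownian_motion M F W"
  obtains W' where "AE \<omega> in M. \<forall>t. W' t \<omega> = W t \<omega>" "\<And>t. 0 \<le> t \<Longrightarrow> W' t \<in> borel_measurable (F t)"
    "\<And>\<omega>. continuous_on {0..} (\<lambda>t. W' t \<omega>)"
proof -
  have "AE \<omega> in M. continuous_on {0..} (\<lambda>t. W t \<omega>)"
    using W by (simp add: std_brownian_motion_def)
  then obtain N where N: "\<And>\<omega>. \<omega> \<in> space M - N \<Longrightarrow> continuous_on {0..} (\<lambda>t. W t \<omega>)" "N \<in> null_sets M"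
    by (rule AE_E3) blast
  define W' where "W' t \<omega> = (if \<omega> \<in> space M - N then W t \<omega> else 0)" for t \<omega>
  show thesis
  proof (rule that[of W'])
    show "AE \<omega> in M. \<forall>t. W' t \<omega> = W t \<omega>"
      using AE_not_in[OF N(2)] AE_space by eventually_elim (simp add: W'_def)
  next
    fix t :: real assume t: "0 \<le> t"
    have "N \<in> sets (F 0)" using F N(2) unfolding usual_conditions_def by blast
    moreover have "sets (F 0) \<subseteq> sets (F t)" using F t unfolding usual_conditions_def by blast
    ultimately have [measurable]: "N \<in> sets (F t)" by blast
    have sp: "space (F t) = space M" using F t by (simp add: usual_conditions_def subalgebra_def)
    have [measurable]: "W t \<in> borel_measurable (F t)"
      using W t by (simp add: std_brownian_motion_def)
    have "(\<lambda>\<omega>. if \<omega> \<in> N then 0 else W t \<omega>) \<in> borel_measurable (F t)" by measurable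
    also have "?this \<longleftrightarrow> W' t \<in> borel_measurable (F t)"
      by (intro measurable_cong) (simp add: W'_def sp)
    finally show "W' t \<in> borel_measurable (F t)" .
  next
    show "continuous_on {0..} (\<lambda>t. W' t \<omega>)" for \<omega>
      using N(1) by (cases "\<omega> \<in> space M - N") (auto simp: W'_def)
  qed
qed

lemma continuous_on_segment_space:
  assumes "\<phi> \<in> mspace (segment_space \<tau>)"
  shows "continuous_on {-\<tau>..0} \<phi>"
  using assms by (simp add: segment_space_def mtopology_of_def)

lemma norm_le_segment_norm:
  assumes "\<phi> \<in> mspace (segment_space \<tau>)" "- \<tau> \<le> \<theta>" "\<theta> \<le> 0"
  shows "norm (\<phi> \<theta>) \<le> segment_norm \<tau> \<phi>"
  unfolding segment_norm_def
proof (rule cSUP_upper)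
  have "compact ((\<lambda>\<theta>. norm (\<phi> \<theta>)) ` {-\<tau>..0})"
    by (intro compact_continuous_image continuous_on_norm continuous_on_segment_space assms) auto
  then show "bdd_above ((\<lambda>\<theta>. norm (\<phi> \<theta>)) ` {-\<tau>..0})"
    by (intro bounded_imp_bdd_above compact_imp_bounded)
qed (use assms in auto)

lemma openin_mtopology_of_Pow: "{U. openin (mtopology_of m) U} \<subseteq> Pow (mspace m)"
  using openin_subset by fastforce

lemma space_segment_borel [simp]: "space (segment_borel \<tau>) = mspace (segment_space \<tau>)"
  unfolding segment_borel_def by (rule space_measure_of[OF openin_mtopology_of_Pow])

text \<open>Evaluation is 1-Lipschitz for the supremum distance, so preimages of open sets are open,
  hence generators of the sigma-algebra.\<close>

lemma borel_measurable_segment_eval: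
  fixes \<theta> :: real
  assumes \<theta>: "- \<tau> \<le> \<theta>" "\<theta> \<le> 0"
  shows "(\<lambda>\<phi> :: real \<Rightarrow> real ^ 'm. \<phi> \<theta>) \<in> borel_measurable (segment_borel \<tau>)"
proof (rule borel_measurableI)
  fix U :: "(real ^ 'm) set" assume U: "open U"
  interpret S: Metric_space "mspace (segment_space \<tau> :: (real \<Rightarrow> real ^ 'm) metric)" "mdist (segment_space \<tau>)"
    by (rule Metric_space_mspace_mdist)
  let ?V = "{\<phi> \<in> mspace (segment_space \<tau>). \<phi> \<theta> \<in> U}"
  have "openin S.mtopology ?V"
    unfolding S.openin_mtopology
  proof (intro conjI allI impI)
    fix \<phi> assume \<phi>: "\<phi> \<in> ?V"
    then obtain e where e: "0 < e" "ball (\<phi> \<theta>) e \<subseteq> U"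
      using U by (auto simp: open_contains_ball)
    have "\<psi> \<in> ?V" if "\<psi> \<in> S.mball \<phi> e" for \<psi>
    proof -
      have "dist (\<phi> \<theta>) (\<psi> \<theta>) \<le> mdist (segment_space \<tau>) \<phi> \<psi>"
        using that \<theta> mdist_cfunspace_imp_mdist_le[of \<phi> "top_of_set {-\<tau>..0}" euclidean_metric \<psi>, OF _ _ order_refl, of \<theta>]
        unfolding segment_space_def[symmetric] by simp
      then have "\<psi> \<theta> \<in> ball (\<phi> \<theta>) e" using that by simp
      then show ?thesis using e(2) that by auto
    qed
    then show "\<exists>r>0. S.mball \<phi> r \<subseteq> ?V" using e(1) by blast
  qed auto
  then have "?V \<in> sets (segment_borel \<tau>)"
    unfolding segment_borel_def sets_measure_of[OF openin_mtopology_of_Pow]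
    by (intro sigma_sets.Basic) (simp add: mtopology_of_def)
  moreover have "(\<lambda>\<phi>. \<phi> \<theta>) -` U \<inter> space (segment_borel \<tau>) = ?V" by auto
  ultimately show "(\<lambda>\<phi>. \<phi> \<theta>) -` U \<inter> space (segment_borel \<tau>) \<in> sets (segment_borel \<tau>)" by simp
qed

section \<open>From an exponential bound to a logarithmic rate\<close>

text \<open>Taking logarithms gives c t + 2 ln x \<le> ln K; after division by 2 t the constant
  vanishes in the limit.\<close>

lemma limsup_elog_div_le:
  fixes x :: "nat \<Rightarrow> real"
  assumes t: "filterlim t at_top sequentially" and le: "\<And>n. exp (c * t n) * (x n)\<^sup>2 \<le> K" and x: "\<And>n. 0 \<le> x n"
  shows "limsup (\<lambda>n. elog (x n) / ereal (t n)) \<le> ereal (- (c / 2))"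
proof -
  \<comment> \<open>\<open>K\<close> may be 0 when all \<open>x n\<close> vanish; the maximum makes
    its logarithm meaningful.\<close>
  define K' where "K' = max K 1"
  have K': "0 < K'" "exp (c * t n) * (x n)\<^sup>2 \<le> K'" for n
    using le[of n] by (simp_all add: K'_def)
  have "elog (x n) / ereal (t n) \<le> ereal (ln K' / 2 * inverse (t n) - c / 2)" if "0 < t n" for n
  proof (cases "x n = 0")
    case False
    then have xp: "0 < x n" using x[of n] by simp
    have "ln (exp (c * t n) * (x n)\<^sup>2) \<le> ln K'"
      using K' xp by (subst ln_le_cancel_iff) auto
    then have "c * t n + 2 * ln (x n) \<le> ln K'"
      using xp by (simp add: ln_mult ln_realpow)
    then have "ln (x n) / t n \<le> ln K' / 2 * inverse (t n) - c / 2"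
      using that by (simp add: field_simps)
    then show ?thesis using False that by (simp add: elog_def)
  qed (use that in \<open>simp add: elog_def\<close>)
  then have "eventually (\<lambda>n. elog (x n) / ereal (t n) \<le> ereal (ln K' / 2 * inverse (t n) - c / 2)) sequentially"
    using filterlim_at_top_dense[THEN iffD1, OF t, rule_format, of 0] by (auto elim: eventually_mono)
  then have "limsup (\<lambda>n. elog (x n) / ereal (t n)) \<le> limsup (\<lambda>n. ereal (ln K' / 2 * inverse (t n) - c / 2))"
    by (rule Limsup_mono)
  also have "\<dots> = ereal (ln K' / 2 * 0 - c / 2)"
    by (intro lim_imp_Limsup tendsto_ereal tendsto_intros tendsto_inverse_0_at_top t) simp
  finally show ?thesis by simp
qed

section \<open>The scheme as an adapted process along stopping times\<close>

text \<open>The setting for one fixed \<delta>, with every path continuous. The Brownian motion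
  enters through \<open>W_moment\<close>, which is insensitive to changes on null sets and so holds
  for a modification as well. \<open>K\<close> is a square-integrable bound of the initial segment,
  and \<open>\<mu>\<close> is small enough for the dissipation to absorb the delay.\<close>

locale adaptive_scheme = prob_space M for M :: "'a measure" +
  fixes F :: "real \<Rightarrow> 'a measure" and W :: "real \<Rightarrow> 'a \<Rightarrow> real ^ 'd"
    and \<tau> :: real and \<xi> :: "'a \<Rightarrow> real \<Rightarrow> real ^ 'm" and K :: "'a \<Rightarrow> real"
    and f :: "real ^ 'm \<Rightarrow> real ^ 'm \<Rightarrow> real ^ 'm"
    and g :: "real ^ 'm \<Rightarrow> real ^ 'm \<Rightarrow> real ^ 'd ^ 'm"
    and h :: "real ^ 'm \<Rightarrow> real" and hmin hmax \<alpha>1 \<alpha>2 \<mu> :: real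
  assumes F: "\<And>t. 0 \<le> t \<Longrightarrow> subalgebra M (F t)"
    and F_mono: "\<And>s t. 0 \<le> s \<Longrightarrow> s \<le> t \<Longrightarrow> sets (F s) \<subseteq> sets (F t)"
    and W_meas: "\<And>t. 0 \<le> t \<Longrightarrow> W t \<in> borel_measurable (F t)"
    and W_cont: "\<And>\<omega>. continuous_on {0..} (\<lambda>t. W t \<omega>)"
    and W_moment: "\<And>s r (a :: 'a \<Rightarrow> real ^ 'm) (B :: 'a \<Rightarrow> real ^ 'd ^ 'm). 0 \<le> s \<Longrightarrow> 0 \<le> r \<Longrightarrow>
      a \<in> borel_measurable (F s) \<Longrightarrow> B \<in> borel_measurable (F s) \<Longrightarrow>
      (\<integral>\<^sup>+\<omega>. ennreal ((norm (a \<omega> + B \<omega> *v (W (s + r) \<omega> - W s \<omega>)))\<^sup>2) \<partial>M)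
        \<le> (\<integral>\<^sup>+\<omega>. ennreal ((norm (a \<omega>))\<^sup>2 + real CARD('d) * r * (norm (B \<omega>))\<^sup>2) \<partial>M)"
    and \<tau>: "0 < \<tau>"
    and \<xi>_meas: "\<And>\<theta>. - \<tau> \<le> \<theta> \<Longrightarrow> \<theta> \<le> 0 \<Longrightarrow> (\<lambda>\<omega>. \<xi> \<omega> \<theta>) \<in> borel_measurable (F 0)"
    and \<xi>_cont: "\<And>\<omega>. \<omega> \<in> space M \<Longrightarrow> continuous_on {-\<tau>..0} (\<xi> \<omega>)"
    and K_meas: "K \<in> borel_measurable M"
    and \<xi>_le_K: "\<And>\<omega> \<theta>. \<omega> \<in> space M \<Longrightarrow> - \<tau> \<le> \<theta> \<Longrightarrow> \<theta> \<le> 0 \<Longrightarrow> norm (\<xi> \<omega> \<theta>) \<le> K \<omega>"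
    and K_square: "(\<integral>\<^sup>+\<omega>. ennreal ((K \<omega>)\<^sup>2) \<partial>M) < \<infinity>"
    and f_meas: "case_prod f \<in> borel_measurable borel"
    and g_meas: "case_prod g \<in> borel_measurable borel"
    and h_meas[measurable]: "h \<in> borel_measurable borel"
    and hmin: "0 < hmin" "\<And>x. hmin \<le> h x" and hmax: "\<And>x. h x \<le> hmax" "hmax \<le> 1"
    and \<alpha>2: "0 \<le> \<alpha>2"
    and S2: "\<And>x y. x \<bullet> f x y + 1 / 2 * h x * (norm (f x y))\<^sup>2 + real CARD('d) / 2 * (hs_norm (g x y))\<^sup>2
      \<le> - \<alpha>1 * (norm x)\<^sup>2 + \<alpha>2 * (min (h y) (h x) / h x) * (norm y)\<^sup>2"
    and \<mu>: "0 < \<mu>" "4 * \<alpha>2 * exp (\<mu> * (\<tau> + 2 * hmax)) \<le> 2 * \<alpha>1 - \<mu>"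
begin

definition t where "t n \<omega> = scheme_time h f g \<tau> (\<xi> \<omega>) (\<lambda>s. W s \<omega>) n"
definition X where "X n \<omega> = scheme_value h f g \<tau> (\<xi> \<omega>) (\<lambda>s. W s \<omega>) n"
definition Y where "Y n \<omega> = scheme_step_process h f g \<tau> (\<xi> \<omega>) (\<lambda>s. W s \<omega>) (t n \<omega> - \<tau>)"

lemma h_pos: "0 < h x"
  using hmin by (meson less_le_trans)

lemma t_Suc: "t (Suc n) \<omega> = t n \<omega> + h (X n \<omega>)"
  unfolding t_def X_def by (rule scheme_time_Suc[OF h_pos])

lemma t_0: "t 0 \<omega> = 0"
  unfolding t_def by (rule scheme_time_0[OF h_pos])

lemma t_ge: "real n * hmin \<le> t n \<omega>"
  unfolding t_def by (rule scheme_time_ge[OF hmin hmax(1) \<tau>])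

lemma t_nonneg: "0 \<le> t n \<omega>"
  unfolding t_def by (rule scheme_time_nonneg[OF hmin hmax(1) \<tau>])

lemma X_0: "X 0 \<omega> = \<xi> \<omega> 0"
  unfolding X_def by (rule scheme_value_0[OF h_pos])

lemma X_Suc:
  "X (Suc n) \<omega> = (X n \<omega> + h (X n \<omega>) *\<^sub>R f (X n \<omega>) (Y n \<omega>))
    + g (X n \<omega>) (Y n \<omega>) *v (W (t n \<omega> + h (X n \<omega>)) \<omega> - W (t n \<omega>) \<omega>)"
  using scheme_value_Suc[OF h_pos \<tau>, where f = f and g = g and \<xi> = "\<xi> \<omega>" and w = "\<lambda>s. W s \<omega>" and n = n]
    scheme_step_process_scheme_time[OF hmin hmax(1) \<tau>, where f = f and g = g and \<xi> = "\<xi> \<omega>"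
      and w = "\<lambda>s. W s \<omega>" and n = n]
    t_Suc[of n \<omega>]
  by (simp add: X_def Y_def t_def)

lemma scheme_measurable_at:
  assumes N: "space N \<subseteq> space M"
    and \<xi>: "\<forall>\<theta>. - \<tau> \<le> \<theta> \<longrightarrow> \<theta> \<le> 0 \<longrightarrow> (\<lambda>\<omega>. \<xi> \<omega> \<theta>) \<in> borel_measurable N"
    and W: "\<forall>u \<in> borel_measurable N. (\<forall>\<omega> \<in> space N. 0 \<le> u \<omega> \<and> u \<omega> \<le> t n \<omega>) \<longrightarrow>
      (\<lambda>\<omega>. W (u \<omega>) \<omega>) \<in> borel_measurable N"
  shows "t n \<in> borel_measurable N" "X n \<in> borel_measurable N" "Y n \<in> borel_measurable N"
proof -
  let ?st = "\<lambda>\<omega>. scheme_state h f g \<tau> (\<xi> \<omega>) (\<lambda>s. W s \<omega>) n"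
  have fst_st: "fst (?st \<omega>) = t n \<omega>" for \<omega> by (simp add: t_def scheme_time_def)
  have \<xi>': "\<forall>v \<in> borel_measurable N. (\<forall>\<omega> \<in> space N. - \<tau> \<le> v \<omega> \<and> v \<omega> \<le> 0) \<longrightarrow>
      (\<lambda>\<omega>. \<xi> \<omega> (v \<omega>)) \<in> borel_measurable N"
  proof (intro ballI impI)
    fix v assume v: "v \<in> borel_measurable N" "\<forall>\<omega> \<in> space N. - \<tau> \<le> v \<omega> \<and> v \<omega> \<le> 0"
    show "(\<lambda>\<omega>. \<xi> \<omega> (v \<omega>)) \<in> borel_measurable N"
    proof (rule measurable_continuous_process[where Z = "\<lambda>s \<omega>. \<xi> \<omega> s" and I = "{-\<tau>..0}"
            and r = "\<lambda>x. max (- \<tau>) (min 0 x)"])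
      show "continuous_on UNIV (\<lambda>x. max (- \<tau>) (min 0 x))" by (intro continuous_intros)
    qed (use v \<tau> \<xi> \<xi>_cont N in auto)
  qed
  note sm = scheme_measurable[where \<xi> = \<xi> and W = W and n = n and N = N,
      OF h_pos \<tau> h_meas f_meas g_meas \<xi>', unfolded fst_st, OF W]
  have tm: "t n \<in> borel_measurable N"
    and st: "\<And>s. s \<in> borel_measurable N \<Longrightarrow> (\<And>\<omega>. - \<tau> \<le> s \<omega>) \<Longrightarrow> (\<lambda>\<omega>. snd (?st \<omega>) (s \<omega>)) \<in> borel_measurable N"
    using sm by simp_all
  show "t n \<in> borel_measurable N" by (rule tm)
  have "- \<tau> \<le> t n \<omega>" for \<omega> using t_nonneg[of n \<omega>] \<tau> by linarith
  then have "(\<lambda>\<omega>. snd (?st \<omega>) (t n \<omega>)) \<in> borel_measurable N"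
    by (intro st tm)
  then show "X n \<in> borel_measurable N"
    by (simp add: X_def[abs_def] scheme_value_def t_def)
  have "(\<lambda>\<omega>. snd (?st \<omega>) (t n \<omega> - \<tau>)) \<in> borel_measurable N"
    using tm t_nonneg by (intro st) auto
  also have "(\<lambda>\<omega>. snd (?st \<omega>) (t n \<omega> - \<tau>)) = Y n"
  proof
    fix \<omega>
    \<comment> \<open>The delayed time precedes the end of step n, so state n already shows the
      piecewise constant process there.\<close>
    have "t n \<omega> - \<tau> < t (Suc n) \<omega>" using \<tau> h_pos[of "X n \<omega>"] by (simp add: t_Suc)
    then show "snd (?st \<omega>) (t n \<omega> - \<tau>) = Y n \<omega>"
      unfolding Y_def t_def by (intro scheme_state_eq[OF h_pos])
  qed
  finally show "Y n \<in> borel_measurable N" .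
qed

lemma space_F: "0 \<le> s \<Longrightarrow> space (F s) = space M"
  using F by (simp add: subalgebra_def)

lemma measurable_F_mono: "0 \<le> s \<Longrightarrow> s \<le> q \<Longrightarrow> z \<in> borel_measurable (F s) \<Longrightarrow> z \<in> borel_measurable (F q)"
  by (rule measurable_from_subalg[of _ "F s"]) (simp add: subalgebra_def F_mono space_F)

text \<open>On \<open>S\<close> the first n steps read \<open>W\<close> at times in [0, q] only,
  where it is \<open>F q\<close>-measurable; hence the retraction onto [0, q].\<close>

lemma scheme_measurable_stopped:
  assumes q: "0 \<le> q" and S: "S \<in> sets (F q)" "S \<subseteq> {\<omega> \<in> space M. t n \<omega> \<le> q}"
  shows "t n \<in> borel_measurable (restrict_space (F q) S)" "X n \<in> borel_measurable (restrict_space (F q) S)"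
    "Y n \<in> borel_measurable (restrict_space (F q) S)"
proof -
  let ?N = "restrict_space (F q) S"
  have sp: "space ?N \<subseteq> S" by (auto simp: space_restrict_space)
  have 1: "space ?N \<subseteq> space M" using sp S by auto
  have 2: "(\<lambda>\<omega>. \<xi> \<omega> \<theta>) \<in> borel_measurable ?N" if "- \<tau> \<le> \<theta>" "\<theta> \<le> 0" for \<theta>
    using measurable_F_mono[OF order_refl q \<xi>_meas[OF that]] by (rule measurable_restrict_space1)
  have 3: "(\<lambda>\<omega>. W (u \<omega>) \<omega>) \<in> borel_measurable ?N"
    if "u \<in> borel_measurable ?N" "\<And>\<omega>. \<omega> \<in> space ?N \<Longrightarrow> 0 \<le> u \<omega> \<and> u \<omega> \<le> t n \<omega>" for u
  proof (rule measurable_continuous_process[where r = "\<lambda>x. max 0 (min q x)" and I = "{0..q}"])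
    show "continuous_on UNIV (\<lambda>x. max 0 (min q x))" by (intro continuous_intros)
    show "W s \<in> borel_measurable ?N" if "s \<in> {0..q}" for s
      using that by (intro measurable_restrict_space1 measurable_F_mono[OF _ _ W_meas[of s]]) auto
    show "continuous_on {0..q} (\<lambda>s. W s \<omega>)" for \<omega>
      by (rule continuous_on_subset[OF W_cont]) auto
    show "u \<omega> \<in> {0..q}" if "\<omega> \<in> space ?N" for \<omega>
      using that \<open>\<omega> \<in> space ?N \<Longrightarrow> 0 \<le> u \<omega> \<and> u \<omega> \<le> t n \<omega>\<close> sp S(2) by force
  qed (use q that in auto)
  show "t n \<in> borel_measurable ?N" "X n \<in> borel_measurable ?N" "Y n \<in> borel_measurable ?N"
    using scheme_measurable_at[OF 1, of n] 2 3 by simp_all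
qed

text \<open>On the event \<open>t n \<le> q\<close> the next grid point is a function of data known
  at \<open>q\<close>, and the event for \<open>Suc n\<close> is contained in it.\<close>

lemma t_stopping: "0 \<le> q \<Longrightarrow> {\<omega> \<in> space M. t n \<omega> \<le> q} \<in> sets (F q)"
proof (induction n)
  case 0
  then show ?case using sets.top[of "F q"] by (simp add: t_0 space_F)
next
  case (Suc n)
  let ?S = "{\<omega> \<in> space M. t n \<omega> \<le> q}"
  let ?N = "restrict_space (F q) ?S"
  have S: "?S \<in> sets (F q)" using Suc by simp
  note [measurable] = scheme_measurable_stopped(1,2)[OF Suc.prems S order_refl]
  have "{\<omega> \<in> space ?N. t n \<omega> + h (X n \<omega>) \<le> q} \<in> sets ?N" by measurable
  moreover have "{\<omega> \<in> space ?N. t n \<omega> + h (X n \<omega>) \<le> q} = {\<omega> \<in> space M. t (Suc n) \<omega> \<le> q}"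
    using h_pos Suc.prems
    by (auto simp: space_restrict_space space_F t_Suc intro: order_trans[OF less_imp_le[OF less_add_same_cancel1[THEN iffD2]]])
  moreover have "?S \<inter> space (F q) \<in> sets (F q)" using S by (simp add: sets.Int_space_eq2)
  ultimately show ?case by (metis (no_types, lifting) sets_restrict_space_iff)
qed

lemma scheme_measurable_M [measurable]:
  "t n \<in> borel_measurable M" "X n \<in> borel_measurable M" "Y n \<in> borel_measurable M"
proof -
  have 1: "space M \<subseteq> space M" by simp
  have 2: "(\<lambda>\<omega>. \<xi> \<omega> \<theta>) \<in> borel_measurable M" if "- \<tau> \<le> \<theta>" "\<theta> \<le> 0" for \<theta>
    by (rule measurable_from_subalg[OF F \<xi>_meas[OF that]]) simp
  have 3: "(\<lambda>\<omega>. W (u \<omega>) \<omega>) \<in> borel_measurable M"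
    if "u \<in> borel_measurable M" "\<And>\<omega>. \<omega> \<in> space M \<Longrightarrow> 0 \<le> u \<omega> \<and> u \<omega> \<le> t n \<omega>" for u
  proof (rule measurable_continuous_process[where r = "max 0" and I = "{0..}"])
    show "continuous_on UNIV (max (0 :: real))" by (intro continuous_intros)
    show "W s \<in> borel_measurable M" if "s \<in> {0..}" for s
      using that by (intro measurable_from_subalg[OF F W_meas[of s]]) auto
  qed (use that W_cont in auto)
  show "t n \<in> borel_measurable M" "X n \<in> borel_measurable M" "Y n \<in> borel_measurable M"
    using scheme_measurable_at[OF 1, of n] 2 3 by simp_all
qed

lemma measurable_coefficients:
  assumes [measurable]: "X n \<in> borel_measurable N" "Y n \<in> borel_measurable N"
  shows "(\<lambda>\<omega>. f (X n \<omega>) (Y n \<omega>)) \<in> borel_measurable N" "(\<lambda>\<omega>. g (X n \<omega>) (Y n \<omega>)) \<in> borel_measurable N"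
  using measurable_compose[of "\<lambda>\<omega>. (X n \<omega>, Y n \<omega>)" N borel "case_prod f" borel] f_meas
    measurable_compose[of "\<lambda>\<omega>. (X n \<omega>, Y n \<omega>)" N borel "case_prod g" borel] g_meas by auto

section \<open>The weighted second moment stays bounded\<close>

definition V where "V n \<omega> = exp (\<mu> * t n \<omega>) * (norm (X n \<omega>))\<^sup>2"
text \<open>The delay term that S2 leaves in step n, up to the factor \<open>2 * \<alpha>2\<close>.
  Its weight is that of the end of the step, where \<open>V (Suc n)\<close> is taken.\<close>

definition D where "D n \<omega> = exp (\<mu> * t (Suc n) \<omega>) * (min (h (Y n \<omega>)) (h (X n \<omega>)) * (norm (Y n \<omega>))\<^sup>2)"

lemma V_meas [measurable]: "V n \<in> borel_measurable M"
  unfolding V_def[abs_def] by measurable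

lemma D_meas [measurable]: "D n \<in> borel_measurable M"
  unfolding D_def[abs_def] by measurable

lemma V_nonneg: "0 \<le> V n \<omega>" by (simp add: V_def)

lemma D_nonneg: "0 \<le> D n \<omega>" using h_pos by (simp add: D_def less_imp_le)

lemma V_Suc_le:
  "(\<integral>\<^sup>+\<omega>. ennreal (V (Suc n) \<omega>) \<partial>M)
    \<le> (\<integral>\<^sup>+\<omega>. ennreal (exp (\<mu> * t (Suc n) \<omega>) * ((norm (X n \<omega> + h (X n \<omega>) *\<^sub>R f (X n \<omega>) (Y n \<omega>)))\<^sup>2
        + real CARD('d) * h (X n \<omega>) * (hs_norm (g (X n \<omega>) (Y n \<omega>)))\<^sup>2)) \<partial>M)"
proof -
  \<comment> \<open>The weight is known at \<open>t n\<close>, so it can be moved into the coefficients.\<close>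
  define a where "a \<omega> = exp (\<mu> * t (Suc n) \<omega> / 2) *\<^sub>R (X n \<omega> + h (X n \<omega>) *\<^sub>R f (X n \<omega>) (Y n \<omega>))" for \<omega>
  define B where "B \<omega> = exp (\<mu> * t (Suc n) \<omega> / 2) *\<^sub>R g (X n \<omega>) (Y n \<omega>)" for \<omega>
  have ex: "(exp (\<mu> * t (Suc n) \<omega> / 2))\<^sup>2 = exp (\<mu> * t (Suc n) \<omega>)" for \<omega>
    by (simp add: power2_eq_square flip: exp_add)
  have aB_meas: "a \<in> borel_measurable N" "B \<in> borel_measurable N"
    if [measurable]: "t n \<in> borel_measurable N" "X n \<in> borel_measurable N" "Y n \<in> borel_measurable N" for N
  proof -
    note [measurable] = measurable_coefficients[OF that(2,3)]
    show "a \<in> borel_measurable N" unfolding a_def[abs_def] t_Suc by measurable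
    show "B \<in> borel_measurable N" unfolding B_def[abs_def] t_Suc by measurable
  qed
  have "V (Suc n) \<omega> = (norm (a \<omega> + B \<omega> *v (W (t n \<omega> + h (X n \<omega>)) \<omega> - W (t n \<omega>) \<omega>)))\<^sup>2" for \<omega>
  proof -
    have "a \<omega> + B \<omega> *v (W (t n \<omega> + h (X n \<omega>)) \<omega> - W (t n \<omega>) \<omega>) = exp (\<mu> * t (Suc n) \<omega> / 2) *\<^sub>R X (Suc n) \<omega>"
      by (simp add: X_Suc a_def B_def scaleR_right_distrib scaleR_matrix_vector_assoc)
    then show ?thesis by (simp add: V_def power_mult_distrib ex)
  qed
  then have "(\<integral>\<^sup>+\<omega>. ennreal (V (Suc n) \<omega>) \<partial>M) =
      (\<integral>\<^sup>+\<omega>. ennreal ((norm (a \<omega> + B \<omega> *v (W (t n \<omega> + h (X n \<omega>)) \<omega> - W (t n \<omega>) \<omega>)))\<^sup>2) \<partial>M)"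
    by simp
  also have "\<dots> \<le> (\<integral>\<^sup>+\<omega>. ennreal ((norm (a \<omega>))\<^sup>2 + real CARD('d) * h (X n \<omega>) * (norm (B \<omega>))\<^sup>2) \<partial>M)"
  proof (rule nn_integral_norm_affine_random_time_le[where F = F, OF F _ W_cont W_moment])
    show "W s \<in> borel_measurable M" if "0 \<le> s" for s
      by (rule measurable_from_subalg[OF F[OF that] W_meas[OF that]])
    fix q :: real assume q: "0 \<le> q"
    note st = scheme_measurable_stopped[OF q t_stopping[OF q] order_refl, of n]
    show "{\<omega> \<in> space M. t n \<omega> \<le> q} \<in> sets (F q)" by (rule t_stopping[OF q])
    show "t n \<in> borel_measurable (restrict_space (F q) {\<omega> \<in> space M. t n \<omega> \<le> q})" by (rule st)
    show "(\<lambda>\<omega>. h (X n \<omega>)) \<in> borel_measurable (restrict_space (F q) {\<omega> \<in> space M. t n \<omega> \<le> q})"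
      by (rule measurable_compose[OF st(2) h_meas])
    show "a \<in> borel_measurable (restrict_space (F q) {\<omega> \<in> space M. t n \<omega> \<le> q})"
      "B \<in> borel_measurable (restrict_space (F q) {\<omega> \<in> space M. t n \<omega> \<le> q})"
      by (rule aB_meas[OF st])+
  qed (use t_nonneg h_pos in \<open>auto intro: less_imp_le aB_meas\<close>)
  also have "\<dots> = (\<integral>\<^sup>+\<omega>. ennreal (exp (\<mu> * t (Suc n) \<omega>) * ((norm (X n \<omega> + h (X n \<omega>) *\<^sub>R f (X n \<omega>) (Y n \<omega>)))\<^sup>2
        + real CARD('d) * h (X n \<omega>) * (hs_norm (g (X n \<omega>) (Y n \<omega>)))\<^sup>2)) \<partial>M)"
    by (simp add: a_def B_def hs_norm_eq_norm power_mult_distrib ex distrib_left mult_ac)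
  finally show ?thesis .
qed

lemma \<mu>_le: "\<mu> \<le> 2 * \<alpha>1"
  using \<mu> \<alpha>2 by (smt (verit) exp_ge_zero mult_nonneg_nonneg)

text \<open>The one-step inequality in expectation. The dissipation stands on the left, since
  subtraction in \<open>ennreal\<close> is truncated.\<close>

lemma V_step:
  "(\<integral>\<^sup>+\<omega>. ennreal (V (Suc n) \<omega>) \<partial>M) + (\<integral>\<^sup>+\<omega>. ennreal ((2 * \<alpha>1 - \<mu>) * (h (X n \<omega>) * V n \<omega>)) \<partial>M)
    \<le> (\<integral>\<^sup>+\<omega>. ennreal (V n \<omega>) \<partial>M) + (\<integral>\<^sup>+\<omega>. ennreal (2 * \<alpha>2 * D n \<omega>) \<partial>M)"
proof -
  note [measurable] = measurable_coefficients[of n M]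
  let ?U = "\<lambda>\<omega>. exp (\<mu> * t (Suc n) \<omega>) * ((norm (X n \<omega> + h (X n \<omega>) *\<^sub>R f (X n \<omega>) (Y n \<omega>)))\<^sup>2
        + real CARD('d) * h (X n \<omega>) * (hs_norm (g (X n \<omega>) (Y n \<omega>)))\<^sup>2)"
  let ?G = "\<lambda>\<omega>. (2 * \<alpha>1 - \<mu>) * (h (X n \<omega>) * V n \<omega>)"
  have [measurable]: "?U \<in> borel_measurable M" unfolding hs_norm_eq_norm by measurable
  have U0: "0 \<le> ?U \<omega>" for \<omega> using h_pos by (simp add: less_imp_le)
  have G0: "0 \<le> ?G \<omega>" for \<omega> using h_pos \<mu>_le by (simp add: less_imp_le V_nonneg)
  have "?U \<omega> + ?G \<omega> \<le> V n \<omega> + 2 * \<alpha>2 * D n \<omega>" for \<omega>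
    using scheme_second_moment_step_le[OF hmin hmax(1) \<tau> S2 less_imp_le[OF \<mu>(1)] \<mu>_le,
      where n = n and \<xi> = "\<xi> \<omega>" and w = "\<lambda>s. W s \<omega>"]
    by (simp add: V_def D_def X_def[symmetric] t_def[symmetric] Y_def[symmetric])
  then have "(\<integral>\<^sup>+\<omega>. ennreal (?U \<omega>) + ennreal (?G \<omega>) \<partial>M) \<le> (\<integral>\<^sup>+\<omega>. ennreal (V n \<omega>) + ennreal (2 * \<alpha>2 * D n \<omega>) \<partial>M)"
    using \<alpha>2 by (intro nn_integral_mono) (simp add: U0 G0 V_nonneg D_nonneg ennreal_leI flip: ennreal_plus)
  then have "(\<integral>\<^sup>+\<omega>. ennreal (?U \<omega>) \<partial>M) + (\<integral>\<^sup>+\<omega>. ennreal (?G \<omega>) \<partial>M)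
      \<le> (\<integral>\<^sup>+\<omega>. ennreal (V n \<omega>) \<partial>M) + (\<integral>\<^sup>+\<omega>. ennreal (2 * \<alpha>2 * D n \<omega>) \<partial>M)"
    by (subst (asm) (1 2) nn_integral_add) measurable
  with V_Suc_le[of n] show ?thesis
    by (meson add_right_mono order_trans)
qed

text \<open>Summing \<open>V_step\<close> over n telescopes. The accumulated delay terms are at most
  a multiple of the mean square of \<open>K\<close> plus the accumulated dissipation, and the latter
  cancels.\<close>

lemma V_bounded: "\<exists>L<\<infinity>. \<forall>n. (\<integral>\<^sup>+\<omega>. ennreal (V n \<omega>) \<partial>M) \<le> L"
proof -
  let ?EV = "\<lambda>n. \<integral>\<^sup>+\<omega>. ennreal (V n \<omega>) \<partial>M"
  let ?EG = "\<lambda>n. \<integral>\<^sup>+\<omega>. ennreal ((2 * \<alpha>1 - \<mu>) * (h (X n \<omega>) * V n \<omega>)) \<partial>M"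
  let ?ED = "\<lambda>n. \<integral>\<^sup>+\<omega>. ennreal (2 * \<alpha>2 * D n \<omega>) \<partial>M"
  define C where "C = 2 * \<alpha>2 * (exp (\<mu> * (\<tau> + hmax)) * (\<tau> + hmax))"
  define L where "L = ?EV 0 + ennreal C * (\<integral>\<^sup>+\<omega>. ennreal ((K \<omega>)\<^sup>2) \<partial>M)"
  note [measurable] = K_meas
  have hmax0: "0 < hmax" using h_pos[of 0] hmax(1)[of 0] by linarith
  have C0: "0 \<le> C" using \<alpha>2 \<tau> hmax0 by (simp add: C_def)
  have G0: "0 \<le> (2 * \<alpha>1 - \<mu>) * (h (X n \<omega>) * V n \<omega>)" for n \<omega>
    using h_pos \<mu>_le by (simp add: less_imp_le V_nonneg)
  have D0: "0 \<le> 2 * \<alpha>2 * D n \<omega>" for n \<omega> using \<alpha>2 D_nonneg by simp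
  have tele: "?EV N + (\<Sum>n<N. ?EG n) \<le> ?EV 0 + (\<Sum>n<N. ?ED n)" for N
  proof (induction N)
    case (Suc N)
    have "?EV (Suc N) + (\<Sum>n<Suc N. ?EG n) = (?EV (Suc N) + ?EG N) + (\<Sum>n<N. ?EG n)"
      by (simp add: ac_simps)
    also have "\<dots> \<le> (?EV N + ?ED N) + (\<Sum>n<N. ?EG n)"
      by (intro add_right_mono V_step)
    also have "\<dots> = (?EV N + (\<Sum>n<N. ?EG n)) + ?ED N" by (simp add: ac_simps)
    also have "\<dots> \<le> (?EV 0 + (\<Sum>n<N. ?ED n)) + ?ED N"
      by (intro add_right_mono Suc.IH)
    finally show ?case by (simp add: ac_simps)
  qed simp
  have delay: "(\<Sum>n<N. ?ED n) \<le> ennreal C * (\<integral>\<^sup>+\<omega>. ennreal ((K \<omega>)\<^sup>2) \<partial>M) + (\<Sum>n<N. ?EG n)" for N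
  proof -
    have "(\<Sum>n<N. 2 * \<alpha>2 * D n \<omega>) \<le> C * (K \<omega>)\<^sup>2 + (\<Sum>n<N. (2 * \<alpha>1 - \<mu>) * (h (X n \<omega>) * V n \<omega>))"
      if "\<omega> \<in> space M" for \<omega>
    proof -
      have S: "(\<Sum>n<N. D n \<omega>) \<le> exp (\<mu> * (\<tau> + hmax)) * (\<tau> + hmax) * (K \<omega>)\<^sup>2
          + 2 * exp (\<mu> * (\<tau> + 2 * hmax)) * (\<Sum>k<N. h (X k \<omega>) * V k \<omega>)"
        unfolding D_def V_def X_def t_def Y_def
        using \<xi>_le_K[OF that] \<mu>(1) by (intro sum_delayed_le[OF hmin hmax(1) \<tau>]) auto
      have "(\<Sum>n<N. 2 * \<alpha>2 * D n \<omega>) = 2 * \<alpha>2 * (\<Sum>n<N. D n \<omega>)" by (simp add: sum_distrib_left)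
      also have "\<dots> \<le> 2 * \<alpha>2 * (exp (\<mu> * (\<tau> + hmax)) * (\<tau> + hmax) * (K \<omega>)\<^sup>2
          + 2 * exp (\<mu> * (\<tau> + 2 * hmax)) * (\<Sum>k<N. h (X k \<omega>) * V k \<omega>))"
        using S \<alpha>2 by (intro mult_left_mono) auto
      also have "\<dots> = C * (K \<omega>)\<^sup>2 + 4 * \<alpha>2 * exp (\<mu> * (\<tau> + 2 * hmax)) * (\<Sum>k<N. h (X k \<omega>) * V k \<omega>)"
        by (simp add: C_def algebra_simps)
      \<comment> \<open>The choice of \<open>\<mu>\<close> is made for this line.\<close>
      also have "\<dots> \<le> C * (K \<omega>)\<^sup>2 + (2 * \<alpha>1 - \<mu>) * (\<Sum>k<N. h (X k \<omega>) * V k \<omega>)"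
        using \<mu>(2) h_pos by (intro add_left_mono mult_right_mono sum_nonneg mult_nonneg_nonneg V_nonneg) (auto simp: less_imp_le)
      finally show ?thesis by (simp add: sum_distrib_left)
    qed
    then have "(\<integral>\<^sup>+\<omega>. (\<Sum>n<N. ennreal (2 * \<alpha>2 * D n \<omega>)) \<partial>M)
      \<le> (\<integral>\<^sup>+\<omega>. ennreal C * ennreal ((K \<omega>)\<^sup>2) + (\<Sum>n<N. ennreal ((2 * \<alpha>1 - \<mu>) * (h (X n \<omega>) * V n \<omega>))) \<partial>M)"
      by (intro nn_integral_mono) (simp add: sum_ennreal D0 G0 C0 sum_nonneg ennreal_leI flip: ennreal_plus ennreal_mult)
    then show ?thesis
      by (simp add: nn_integral_sum nn_integral_add nn_integral_cmult)
  qed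
  have "?EV 0 \<le> (\<integral>\<^sup>+\<omega>. ennreal ((K \<omega>)\<^sup>2) \<partial>M)"
    using \<tau> by (intro nn_integral_mono ennreal_leI) (simp add: V_def t_0 X_0 \<xi>_le_K power_mono)
  then have EV0: "?EV 0 < \<infinity>" using K_square by (rule le_less_trans)
  then have L: "L < \<infinity>" using K_square by (simp add: L_def ennreal_mult_less_top)
  have "?EV N \<le> L" for N
  \<comment> \<open>The accumulated dissipation can be cancelled in \<open>ennreal\<close> only if
    it is finite. This follows from the bounds at earlier indices and \<open>h \<le> 1\<close>,
    hence the strong induction.\<close>
  proof (induction N rule: less_induct)
    case (less N)
    have "?EG n < \<infinity>" if "n < N" for n
    proof -
      have "?EG n \<le> (\<integral>\<^sup>+\<omega>. ennreal (2 * \<alpha>1 - \<mu>) * ennreal (V n \<omega>) \<partial>M)"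
      proof (intro nn_integral_mono)
        fix \<omega>
        have "h (X n \<omega>) * V n \<omega> \<le> 1 * V n \<omega>"
          using hmax by (intro mult_right_mono V_nonneg) (meson order_trans)
        then show "ennreal ((2 * \<alpha>1 - \<mu>) * (h (X n \<omega>) * V n \<omega>)) \<le> ennreal (2 * \<alpha>1 - \<mu>) * ennreal (V n \<omega>)"
          using \<mu>_le V_nonneg by (simp add: mult_left_mono ennreal_leI flip: ennreal_mult)
      qed
      also have "\<dots> = ennreal (2 * \<alpha>1 - \<mu>) * ?EV n" by (simp add: nn_integral_cmult)
      also have "\<dots> < \<infinity>" using less[OF that] L by (simp add: ennreal_mult_less_top le_less_trans)
      finally show ?thesis .
    qed
    then have fin: "(\<Sum>n<N. ?EG n) \<noteq> \<infinity>" by (simp add: less_top[symmetric] ennreal_sum_less_top)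
    have "(\<Sum>n<N. ?EG n) + ?EV N \<le> ?EV 0 + (\<Sum>n<N. ?ED n)"
      using tele[of N] by (simp add: add.commute)
    also have "\<dots> \<le> (\<Sum>n<N. ?EG n) + L"
      unfolding L_def using add_left_mono[OF delay[of N], of "?EV 0"] by (simp add: ac_simps)
    finally show ?case using fin by (simp add: ennreal_add_left_cancel_le)
  qed
  with L show ?thesis by blast
qed

text \<open>Half of the weight is given up: by \<open>t_ge\<close>, exp(-\<mu> t/2) is at most
  \<open>\<rho> ^ n\<close>, which makes the expectations summable.\<close>

lemma AE_exponentially_bounded: "AE \<omega> in M. \<exists>C. \<forall>n. exp (\<mu> / 2 * t n \<omega>) * (norm (X n \<omega>))\<^sup>2 \<le> C"
proof -
  let ?b = "\<lambda>n \<omega>. exp (\<mu> / 2 * t n \<omega>) * (norm (X n \<omega>))\<^sup>2"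
  define \<rho> where "\<rho> = exp (- (\<mu> / 2 * hmin))"
  have \<rho>: "0 < \<rho>" "\<rho> < 1" using \<mu>(1) hmin(1) by (auto simp: \<rho>_def)
  obtain L where L: "L < \<infinity>" "\<And>n. (\<integral>\<^sup>+\<omega>. ennreal (V n \<omega>) \<partial>M) \<le> L" using V_bounded by blast
  have b_le: "?b n \<omega> \<le> \<rho> ^ n * V n \<omega>" for n \<omega>
  proof -
    have "\<mu> / 2 * (real n * hmin) \<le> \<mu> / 2 * t n \<omega>" using \<mu>(1) t_ge by (intro mult_left_mono) auto
    then have "\<mu> / 2 * t n \<omega> \<le> real n * (- (\<mu> / 2 * hmin)) + \<mu> * t n \<omega>"
      by (simp add: algebra_simps)
    then have "exp (\<mu> / 2 * t n \<omega>) \<le> \<rho> ^ n * exp (\<mu> * t n \<omega>)"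
      unfolding \<rho>_def exp_of_nat_mult[symmetric] exp_add[symmetric] by simp
    then have "?b n \<omega> \<le> (\<rho> ^ n * exp (\<mu> * t n \<omega>)) * (norm (X n \<omega>))\<^sup>2" by (rule mult_right_mono) simp
    then show ?thesis by (simp add: V_def mult.assoc)
  qed
  have "(\<integral>\<^sup>+\<omega>. (\<Sum>n. ennreal (?b n \<omega>)) \<partial>M) = (\<Sum>n. \<integral>\<^sup>+\<omega>. ennreal (?b n \<omega>) \<partial>M)"
    by (rule nn_integral_suminf) measurable
  also have "\<dots> \<le> (\<Sum>n. ennreal (\<rho> ^ n) * L)"
  proof (intro suminf_le)
    fix n
    have "(\<integral>\<^sup>+\<omega>. ennreal (?b n \<omega>) \<partial>M) \<le> (\<integral>\<^sup>+\<omega>. ennreal (\<rho> ^ n) * ennreal (V n \<omega>) \<partial>M)"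
      using b_le \<rho> V_nonneg by (intro nn_integral_mono) (simp add: ennreal_leI flip: ennreal_mult)
    also have "\<dots> = ennreal (\<rho> ^ n) * (\<integral>\<^sup>+\<omega>. ennreal (V n \<omega>) \<partial>M)" by (simp add: nn_integral_cmult)
    also have "\<dots> \<le> ennreal (\<rho> ^ n) * L" by (intro mult_left_mono L) simp
    finally show "(\<integral>\<^sup>+\<omega>. ennreal (?b n \<omega>) \<partial>M) \<le> ennreal (\<rho> ^ n) * L" .
  qed auto
  also have "\<dots> = ennreal (\<Sum>n. \<rho> ^ n) * L"
    using \<rho> by (simp add: ennreal_suminf_multc suminf_ennreal2 summable_geometric)
  also have "\<dots> < \<infinity>" using L(1) by (simp add: ennreal_mult_less_top)
  finally have "AE \<omega> in M. (\<Sum>n. ennreal (?b n \<omega>)) \<noteq> \<infinity>"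
    by (intro nn_integral_PInf_AE) simp_all
  then show ?thesis
  proof eventually_elim
    case (elim \<omega>)
    define S where "S = (\<Sum>n. ennreal (?b n \<omega>))"
    have S: "ennreal (enn2real S) = S"
      using elim unfolding S_def[symmetric] by (intro ennreal_enn2real) (simp add: less_top)
    have "?b n \<omega> \<le> enn2real S" for n
    proof -
      have "sum (\<lambda>n. ennreal (?b n \<omega>)) {n} \<le> S"
        unfolding S_def by (rule sum_le_suminf) (auto intro: summableI)
      then have "ennreal (?b n \<omega>) \<le> ennreal (enn2real S)"
        unfolding S by simp
      then show ?thesis by (simp only: ennreal_le_iff[OF enn2real_nonneg])
    qed
    then show ?case by blast
  qed
qed

lemma filterlim_t: "filterlim (\<lambda>n. t n \<omega>) at_top sequentially"
proof (rule filterlim_at_top_mono)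
  show "filterlim (\<lambda>n. real n * hmin) at_top sequentially"
    using hmin(1) filterlim_real_sequentially by (rule filterlim_at_top_mult_tendsto_pos[OF tendsto_const])
qed (simp add: t_ge)

text \<open>Half of \<open>\<mu>\<close> was spent on summability, and passing from the squared norm
  to the norm halves the rest.\<close>

theorem AE_exponentially_stable:
  "AE \<omega> in M. limsup (\<lambda>n. elog (norm (X n \<omega>)) / ereal (t n \<omega>)) \<le> ereal (- (\<mu> / 4))"
  using AE_exponentially_bounded
proof eventually_elim
  case (elim \<omega>)
  then obtain C where "\<And>n. exp (\<mu> / 2 * t n \<omega>) * (norm (X n \<omega>))\<^sup>2 \<le> C" by blast
  from limsup_elog_div_le[OF filterlim_t this] show ?case by simp
qed

end

section \<open>Choice of the rate and the stability theorem\<close>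

text \<open>At \<mu> = 0 the inequality reads 4 \<alpha>2 \<le> 2 \<alpha>1 and holds strictly; by
  continuity it persists for small positive \<mu>.\<close>

lemma exists_rate:
  fixes \<alpha>1 \<alpha>2 c :: real
  assumes "2 * \<alpha>2 < \<alpha>1"
  shows "\<exists>\<mu>>0. 4 * \<alpha>2 * exp (\<mu> * c) \<le> 2 * \<alpha>1 - \<mu>"
proof -
  have "((\<lambda>\<mu>. 2 * \<alpha>1 - \<mu> - 4 * \<alpha>2 * exp (\<mu> * c)) \<longlongrightarrow> 2 * \<alpha>1 - 0 - 4 * \<alpha>2 * exp (0 * c)) (at_right 0)"
    by (intro tendsto_intros)
  then have "\<forall>\<^sub>F \<mu> in at_right 0. 0 < 2 * \<alpha>1 - \<mu> - 4 * \<alpha>2 * exp (\<mu> * c)"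
    using assms by (intro order_tendstoD(1)) auto
  then have "\<forall>\<^sub>F \<mu> in at_right 0. 0 < \<mu> \<and> 4 * \<alpha>2 * exp (\<mu> * c) \<le> 2 * \<alpha>1 - \<mu>"
    using eventually_at_right_less[of "0 :: real"] by eventually_elim auto
  then show ?thesis
    using eventually_happens[of _ "at_right (0 :: real)"] by fastforce
qed

theorem theorem6p4:
  fixes M :: "'a measure" and F :: "real \<Rightarrow> 'a measure"
    and W :: "real \<Rightarrow> 'a \<Rightarrow> real ^ 'd"
    and \<tau> :: real and \<xi> :: "'a \<Rightarrow> real \<Rightarrow> real ^ 'm"
    and f :: "real ^ 'm \<Rightarrow> real ^ 'm \<Rightarrow> real ^ 'm"
    and g :: "real ^ 'm \<Rightarrow> real ^ 'm \<Rightarrow> real ^ 'd ^ 'm"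
    and h :: "real \<Rightarrow> real ^ 'm \<Rightarrow> real" and \<delta> :: real
  assumes "prob_space M" and "complete_measure M"
    and "usual_conditions M F"
    and "std_brownian_motion M F W"
    and "\<tau> > 0"
    and "initial_segment M F \<tau> \<xi>"
    and "case_prod f \<in> borel_measurable borel"
    and "case_prod g \<in> borel_measurable borel"
    and "assumption_S1 f g"
    and "assumption_S2 f g h"
    and "\<delta> \<in> {0<..<1}"
  shows "\<exists>rate>0. AE \<omega> in M.
           limsup (\<lambda>n. elog (norm (scheme_value (h \<delta>) f g \<tau> (\<xi> \<omega>) (\<lambda>t. W t \<omega>) n))
                       / ereal (scheme_time (h \<delta>) f g \<tau> (\<xi> \<omega>) (\<lambda>t. W t \<omega>) n))
             \<le> ereal (- rate)"
proof -
  interpret prob_space M by fact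
  have "continuous_on UNIV (h \<delta>) \<and> (\<exists>\<alpha>\<^sub>1 \<alpha>\<^sub>2. \<alpha>\<^sub>1 > \<alpha>\<^sub>2 \<and> \<alpha>\<^sub>2 \<ge> 0 \<and>
      (\<forall>x y. x \<bullet> f x y + 1 / 2 * h \<delta> x * (norm (f x y))\<^sup>2 + real CARD('d) / 2 * (hs_norm (g x y))\<^sup>2
          \<le> - \<alpha>\<^sub>1 * (norm x)\<^sup>2 + \<alpha>\<^sub>2 * (min (h \<delta> y) (h \<delta> x) / h \<delta> x) * (norm y)\<^sup>2) \<and>
      (\<exists>h_min h_max. 0 < h_min \<and> h_min < h_max \<and> h_max < 1 \<and>
         (\<forall>x. h_min \<le> h \<delta> x \<and> h \<delta> x \<le> h_max) \<and> 2 * \<alpha>\<^sub>2 * exp (2 * \<alpha>\<^sub>1 * h_max) < \<alpha>\<^sub>1))"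
    using assms(10,11) unfolding assumption_S2_def by blast
  then obtain \<alpha>1 \<alpha>2 hmin hmax where h_cont: "continuous_on UNIV (h \<delta>)"
    and \<alpha>: "\<alpha>1 > \<alpha>2" "\<alpha>2 \<ge> 0"
    and S2: "\<And>x y. x \<bullet> f x y + 1 / 2 * h \<delta> x * (norm (f x y))\<^sup>2 + real CARD('d) / 2 * (hs_norm (g x y))\<^sup>2
          \<le> - \<alpha>1 * (norm x)\<^sup>2 + \<alpha>2 * (min (h \<delta> y) (h \<delta> x) / h \<delta> x) * (norm y)\<^sup>2"
    and hm: "0 < hmin" "hmin < hmax" "hmax < 1" "\<And>x. hmin \<le> h \<delta> x" "\<And>x. h \<delta> x \<le> hmax"
    and small: "2 * \<alpha>2 * exp (2 * \<alpha>1 * hmax) < \<alpha>1"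
    by blast
  \<comment> \<open>The exponential in the step-size condition is at least 1, so this condition
    yields the strict inequality that leaves room for \<open>\<mu>\<close>.\<close>
  have "2 * \<alpha>2 * 1 \<le> 2 * \<alpha>2 * exp (2 * \<alpha>1 * hmax)"
    using \<alpha> hm by (intro mult_left_mono) auto
  then have "2 * \<alpha>2 < \<alpha>1" using small by simp
  then obtain \<mu> where \<mu>: "0 < \<mu>" "4 * \<alpha>2 * exp (\<mu> * (\<tau> + 2 * hmax)) \<le> 2 * \<alpha>1 - \<mu>"
    using exists_rate by blast
  have sub: "subalgebra M (F t)" if "0 \<le> t" for t
    using assms(3) that by (simp add: usual_conditions_def)
  obtain W' where W'_eq: "AE \<omega> in M. \<forall>t. W' t \<omega> = W t \<omega>"
    and W'_meas: "\<And>t. 0 \<le> t \<Longrightarrow> W' t \<in> borel_measurable (F t)"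
    and W'_cont: "\<And>\<omega>. continuous_on {0..} (\<lambda>t. W' t \<omega>)"
    by (rule brownian_motion_continuous_version[OF assms(3,4)]) blast
  have \<xi>_meas: "\<xi> \<in> F 0 \<rightarrow>\<^sub>M segment_borel \<tau>"
    using assms(6) by (simp add: initial_segment_def)
  have \<xi>_space: "\<xi> \<omega> \<in> mspace (segment_space \<tau>)" if "\<omega> \<in> space M" for \<omega>
    using measurable_space[OF \<xi>_meas, of \<omega>] that sub[of 0] by (simp add: subalgebra_def)
  have seg0: "0 \<le> segment_norm \<tau> (\<xi> \<omega>)" if "\<omega> \<in> space M" for \<omega>
    using norm_le_segment_norm[OF \<xi>_space[OF that], of 0] assms(5) norm_ge_zero by (meson less_imp_le neg_le_0_iff_le order_refl order_trans)
  have "integrable M (\<lambda>\<omega>. segment_norm \<tau> (\<xi> \<omega>) powr 2)"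
    using assms(6) by (simp add: initial_segment_def)
  then have sq_int: "integrable M (\<lambda>\<omega>. (segment_norm \<tau> (\<xi> \<omega>))\<^sup>2)"
    by (subst (asm) Bochner_Integration.integrable_cong[OF refl, of _ _ "\<lambda>\<omega>. (segment_norm \<tau> (\<xi> \<omega>))\<^sup>2"])
       (simp_all add: seg0 powr_numeral)
  \<comment> \<open>Only powers of \<open>segment_norm\<close> are known to be measurable, through their integrability; hence
    the square root of the square.\<close>
  interpret adaptive_scheme M F W' \<tau> \<xi> "\<lambda>\<omega>. sqrt ((segment_norm \<tau> (\<xi> \<omega>))\<^sup>2)" f g "h \<delta>" hmin hmax \<alpha>1 \<alpha>2 \<mu>
  proof unfold_locales
    fix s r :: real and a :: "'a \<Rightarrow> real ^ 'm" and B :: "'a \<Rightarrow> real ^ 'd ^ 'm"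
    assume s: "0 \<le> s" and r: "0 \<le> r" and aB: "a \<in> borel_measurable (F s)" "B \<in> borel_measurable (F s)"
    have "(\<integral>\<^sup>+\<omega>. ennreal ((norm (a \<omega> + B \<omega> *v (W' (s + r) \<omega> - W' s \<omega>)))\<^sup>2) \<partial>M)
        = (\<integral>\<^sup>+\<omega>. ennreal ((norm (a \<omega> + B \<omega> *v (W (s + r) \<omega> - W s \<omega>)))\<^sup>2) \<partial>M)"
      using W'_eq by (intro nn_integral_cong_AE) (auto elim: eventually_mono)
    also have "\<dots> \<le> (\<integral>\<^sup>+\<omega>. ennreal ((norm (a \<omega>))\<^sup>2 + real CARD('d) * r * (norm (B \<omega>))\<^sup>2) \<partial>M)"
      by (rule brownian_increment_second_moment_le[OF assms(3,4) s r aB])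
    finally show "(\<integral>\<^sup>+\<omega>. ennreal ((norm (a \<omega> + B \<omega> *v (W' (s + r) \<omega> - W' s \<omega>)))\<^sup>2) \<partial>M)
        \<le> (\<integral>\<^sup>+\<omega>. ennreal ((norm (a \<omega>))\<^sup>2 + real CARD('d) * r * (norm (B \<omega>))\<^sup>2) \<partial>M)" .
  next
    show "sets (F s) \<subseteq> sets (F t)" if "0 \<le> s" "s \<le> t" for s t
      using assms(3) that unfolding usual_conditions_def by blast
    show "(\<lambda>\<omega>. \<xi> \<omega> \<theta>) \<in> borel_measurable (F 0)" if "- \<tau> \<le> \<theta>" "\<theta> \<le> 0" for \<theta>
      by (rule measurable_compose[OF \<xi>_meas borel_measurable_segment_eval[OF that]])
    show "continuous_on {-\<tau>..0} (\<xi> \<omega>)" if "\<omega> \<in> space M" for \<omega>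
      by (rule continuous_on_segment_space[OF \<xi>_space[OF that]])
    show "(\<lambda>\<omega>. sqrt ((segment_norm \<tau> (\<xi> \<omega>))\<^sup>2)) \<in> borel_measurable M"
      by (rule measurable_compose[OF borel_measurable_integrable[OF sq_int] borel_measurable_sqrt])
    show "norm (\<xi> \<omega> \<theta>) \<le> sqrt ((segment_norm \<tau> (\<xi> \<omega>))\<^sup>2)" if "\<omega> \<in> space M" "- \<tau> \<le> \<theta>" "\<theta> \<le> 0" for \<omega> \<theta>
      using norm_le_segment_norm[OF \<xi>_space[OF that(1)] that(2,3)] by (simp add: abs_le_iff)
    show "(\<integral>\<^sup>+\<omega>. ennreal ((sqrt ((segment_norm \<tau> (\<xi> \<omega>))\<^sup>2))\<^sup>2) \<partial>M) < \<infinity>"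
      using sq_int by (simp add: nn_integral_eq_integral)
    show "h \<delta> \<in> borel_measurable borel"
      using h_cont by (rule borel_measurable_continuous_onI)
  qed (use assms(5,7,8) sub W'_meas W'_cont hm \<alpha> S2 \<mu> in \<open>auto intro: less_imp_le\<close>)
  \<comment> \<open>Almost surely \<open>W\<close> and its continuous modification have the same
    whole path, so grid points and values of the two schemes coincide.\<close>
  have "AE \<omega> in M. limsup (\<lambda>n. elog (norm (scheme_value (h \<delta>) f g \<tau> (\<xi> \<omega>) (\<lambda>t. W t \<omega>) n))
      / ereal (scheme_time (h \<delta>) f g \<tau> (\<xi> \<omega>) (\<lambda>t. W t \<omega>) n)) \<le> ereal (- (\<mu> / 4))"
    using AE_exponentially_stable W'_eq by eventually_elim (simp add: X_def t_def)
  with \<mu>(1) show ?thesis by (intro exI[of _ "\<mu> / 4"]) simp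
qed

end
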